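(* Let $Y\in\mathbb{R}^{n\times p}$, $x\in\mathbb{R}^n$ with $\|x\|_2=1$, $c=Y^\top x$, and $t>0$, and consider the problem $$\text{(P)}\qquad\min_{d\in\mathbb{R}^n,\,u\in\mathbb{R}^p}\ \frac12\|d\|_2^2+t\|u\|_1\quad\text{s.t.}\quad Y^\top d+c=u,\ \ d^\top x=0.$$ Let $\{(d^j,u^j,y^j,z^j)\}_j$ be a sequence generated by the inexact augmented Lagrangian method (described in the context) in which the subproblems are solved with stopping criterion (A). Then the sequence $\{(d^j,u^j)\}_j$ is bounded and converges to the unique optimal solution of (P). Moreover, if $0<\sigma_j\nearrow\sigma_\infty=\infty$ and the stopping criteria (B) and (C) are also used, then, for all sufficiently large $j$, the sequence $\{(d^j,u^j,y^j,z^j)\}_j$ converges asymptotically superlinearly to the set $\mathcal{K}$ of KKT points of (P); that is, there are $\eta_j\ge0$ with $\eta_j\to0$ such that for all sufficiently large $j$, $$\mathrm{dist}\big((d^{j+1},u^{j+1},y^{j+1},z^{j+1}),\mathcal{K}\big)\le\eta_j\,\mathrm{dist}\big((d^j,u^j,y^j,z^j),\mathcal{K}\big).$$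
   Context: Augmented Lagrangian of (P), for $\sigma>0$, $y\in\mathbb{R}$, $z\in\mathbb{R}^p$: $$\mathcal{L}_\sigma(d,u;y,z)=\tfrac12\|d\|_2^2+t\|u\|_1+y\,d^\top x+\langle z,Y^\top d+c-u\rangle+\tfrac\sigma2(d^\top x)^2+\tfrac\sigma2\|Y^\top d+c-u\|_2^2.$$ Inexact augmented Lagrangian method. Input: $d^0\in\mathbb{R}^n$, $u^0\in\mathbb{R}^p$, $y^0\in\mathbb{R}$, $z^0\in\mathbb{R}^p$, $\sigma_0>0$. For $j=0,1,\dots$: compute an approximate minimizer $(d^{j+1},u^{j+1})$ of $\Psi_j(d,u):=\mathcal{L}_{\sigma_j}(d,u;y^j,z^j)$ over $\mathbb{R}^n\times\mathbb{R}^p$; set $y^{j+1}=y^j+\sigma_j(d^{j+1})^\top x$ and $z^{j+1}=z^j+\sigma_j(Y^\top d^{j+1}+c-u^{j+1})$; choose $\sigma_{j+1}\ge\sigma_j$, with $\sigma_j\nearrow\sigma_\infty\le+\infty$. Stopping criteria, with $\Psi_j^*=\min\Psi_j$ and nonnegative sequences $\varepsilon_j,\delta_j,\delta_j'$: (A) $\Psi_j(d^{j+1},u^{j+1})-\Psi_j^*\le\frac{\varepsilon_j^2}{2\sigma_j}$, with $\sum_{j}\varepsilon_j<\infty$; (B) $\Psi_j(d^{j+1},u^{j+1})-\Psi_j^*\le\frac{\delta_j^2}{2\sigma_j}\|(y^{j+1},z^{j+1})-(y^j,z^j)\|_2^2$, with $\sum_j\delta_j<\infty$; (C) $\mathrm{dist}(0,\partial\Psi_j(d^{j+1},u^{j+1}))\le\frac{\delta_j'}{\sigma_j}\|(y^{j+1},z^{j+1})-(y^j,z^j)\|_2$,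 with $\delta_j'\searrow0$. Here $\partial$ is the convex subdifferential and $\mathrm{dist}$ is Euclidean distance to a set. The set $\mathcal{K}$ of KKT points of (P) consists of all $(d,u,y,z)\in\mathbb{R}^n\times\mathbb{R}^p\times\mathbb{R}\times\mathbb{R}^p$ with $d+yx+Yz=0$, $z\in t\,\partial\|u\|_1$, $Y^\top d+c=u$, and $d^\top x=0$. *)

theory Defs
  imports "HOL-Analysis.Analysis"
begin

definition l1_norm :: "real ^ 'p \<Rightarrow> real" where
  "l1_norm u = (\<Sum>i\<in>UNIV. \<bar>u $ i\<bar>)"

definition subdifferential :: "('a::real_inner \<Rightarrow> real) \<Rightarrow> 'a \<Rightarrow> 'a set" where
  "subdifferential f w = {g. \<forall>v. f w + g \<bullet> (v - w) \<le> f v}"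

definition objective :: "real \<Rightarrow> (real ^ 'n) \<times> (real ^ 'p) \<Rightarrow> real" where
  "objective t = (\<lambda>(d, u). (norm d)\<^sup>2 / 2 + t * l1_norm u)"

definition feasible ::
  "real ^ 'p ^ 'n \<Rightarrow> real ^ 'n \<Rightarrow> real ^ 'p \<Rightarrow> (real ^ 'n) \<times> (real ^ 'p) \<Rightarrow> bool" where
  "feasible Y x c = (\<lambda>(d, u). transpose Y *v d + c = u \<and> d \<bullet> x = 0)"

abbreviation optimal_solution ::
  "real ^ 'p ^ 'n \<Rightarrow> real ^ 'n \<Rightarrow> real ^ 'p \<Rightarrow> real \<Rightarrow> (real ^ 'n) \<times> (real ^ 'p) \<Rightarrow> bool" where
  "optimal_solution Y x c t \<equiv> is_arg_min (objective t) (feasible Y x c)"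

definition aug_lagrangian ::
  "real ^ 'p ^ 'n \<Rightarrow> real ^ 'n \<Rightarrow> real ^ 'p \<Rightarrow> real \<Rightarrow> real \<Rightarrow> real \<Rightarrow> real ^ 'p
    \<Rightarrow> (real ^ 'n) \<times> (real ^ 'p) \<Rightarrow> real" where
  "aug_lagrangian Y x c t \<sigma> y z = (\<lambda>(d, u).
     (norm d)\<^sup>2 / 2 + t * l1_norm u
     + y * (d \<bullet> x) + z \<bullet> (transpose Y *v d + c - u)
     + \<sigma> / 2 * (d \<bullet> x)\<^sup>2 + \<sigma> / 2 * (norm (transpose Y *v d + c - u))\<^sup>2)"

definition kkt_set ::
  "real ^ 'p ^ 'n \<Rightarrow> real ^ 'n \<Rightarrow> real ^ 'p \<Rightarrow> real
    \<Rightarrow> ((real ^ 'n) \<times> (real ^ 'p) \<times> real \<times> (real ^ 'p)) set" where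
  "kkt_set Y x c t = {(d, u, y, z).
     d + y *\<^sub>R x + Y *v z = 0 \<and> z \<in> (\<lambda>g. t *\<^sub>R g) ` subdifferential l1_norm u \<and>
     transpose Y *v d + c = u \<and> d \<bullet> x = 0}"

text \<open>The quality of the approximate minimizers is not part of this predicate; it is imposed
  by the stopping criteria below.\<close>

definition alm_sequence ::
  "real ^ 'p ^ 'n \<Rightarrow> real ^ 'n \<Rightarrow> real ^ 'p \<Rightarrow> (nat \<Rightarrow> real) \<Rightarrow> ereal
    \<Rightarrow> (nat \<Rightarrow> real ^ 'n) \<Rightarrow> (nat \<Rightarrow> real ^ 'p) \<Rightarrow> (nat \<Rightarrow> real) \<Rightarrow> (nat \<Rightarrow> real ^ 'p) \<Rightarrow> bool" where
  "alm_sequence Y x c \<sigma> \<sigma>_inf d u y z \<longleftrightarrow>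
     0 < \<sigma> 0 \<and> (\<forall>j. \<sigma> j \<le> \<sigma> (Suc j)) \<and> (\<lambda>j. ereal (\<sigma> j)) \<longlonglongrightarrow> \<sigma>_inf \<and>
     (\<forall>j. y (Suc j) = y j + \<sigma> j * (d (Suc j) \<bullet> x)) \<and>
     (\<forall>j. z (Suc j) = z j + \<sigma> j *\<^sub>R (transpose Y *v d (Suc j) + c - u (Suc j)))"

text \<open>The infimum below is a minimum, see \<open>aug_lagrangian_min_attained\<close>.\<close>

definition subproblem_gap ::
  "real ^ 'p ^ 'n \<Rightarrow> real ^ 'n \<Rightarrow> real ^ 'p \<Rightarrow> real \<Rightarrow> real \<Rightarrow> real \<Rightarrow> real ^ 'p
    \<Rightarrow> (real ^ 'n) \<times> (real ^ 'p) \<Rightarrow> real" where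
  "subproblem_gap Y x c t \<sigma> y z w =
     aug_lagrangian Y x c t \<sigma> y z w - (INF v. aug_lagrangian Y x c t \<sigma> y z v)"

definition stopping_A ::
  "real ^ 'p ^ 'n \<Rightarrow> real ^ 'n \<Rightarrow> real ^ 'p \<Rightarrow> real \<Rightarrow> (nat \<Rightarrow> real)
    \<Rightarrow> (nat \<Rightarrow> real ^ 'n) \<Rightarrow> (nat \<Rightarrow> real ^ 'p) \<Rightarrow> (nat \<Rightarrow> real) \<Rightarrow> (nat \<Rightarrow> real ^ 'p)
    \<Rightarrow> (nat \<Rightarrow> real) \<Rightarrow> bool" where
  "stopping_A Y x c t \<sigma> d u y z \<epsilon> \<longleftrightarrow>
     (\<forall>j. 0 \<le> \<epsilon> j) \<and> summable \<epsilon> \<and>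
     (\<forall>j. subproblem_gap Y x c t (\<sigma> j) (y j) (z j) (d (Suc j), u (Suc j))
            \<le> (\<epsilon> j)\<^sup>2 / (2 * \<sigma> j))"

definition stopping_B ::
  "real ^ 'p ^ 'n \<Rightarrow> real ^ 'n \<Rightarrow> real ^ 'p \<Rightarrow> real \<Rightarrow> (nat \<Rightarrow> real)
    \<Rightarrow> (nat \<Rightarrow> real ^ 'n) \<Rightarrow> (nat \<Rightarrow> real ^ 'p) \<Rightarrow> (nat \<Rightarrow> real) \<Rightarrow> (nat \<Rightarrow> real ^ 'p)
    \<Rightarrow> (nat \<Rightarrow> real) \<Rightarrow> bool" where
  "stopping_B Y x c t \<sigma> d u y z \<delta> \<longleftrightarrow>
     (\<forall>j. 0 \<le> \<delta> j) \<and> summable \<delta> \<and>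
     (\<forall>j. subproblem_gap Y x c t (\<sigma> j) (y j) (z j) (d (Suc j), u (Suc j))
            \<le> (\<delta> j)\<^sup>2 / (2 * \<sigma> j) * (norm ((y (Suc j), z (Suc j)) - (y j, z j)))\<^sup>2)"

text \<open>Since \<open>infdist w {} = 0\<close>, the use of \<open>infdist\<close> to a subdifferential or to the set of
  KKT points is justified by their nonemptiness, see \<open>subdifferential_aug_lagrangian_nonempty\<close>
  and \<open>kkt_set_nonempty\<close>.\<close>

definition stopping_C ::
  "real ^ 'p ^ 'n \<Rightarrow> real ^ 'n \<Rightarrow> real ^ 'p \<Rightarrow> real \<Rightarrow> (nat \<Rightarrow> real)
    \<Rightarrow> (nat \<Rightarrow> real ^ 'n) \<Rightarrow> (nat \<Rightarrow> real ^ 'p) \<Rightarrow> (nat \<Rightarrow> real) \<Rightarrow> (nat \<Rightarrow> real ^ 'p)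
    \<Rightarrow> (nat \<Rightarrow> real) \<Rightarrow> bool" where
  "stopping_C Y x c t \<sigma> d u y z \<delta>' \<longleftrightarrow>
     (\<forall>j. 0 \<le> \<delta>' j) \<and> decseq \<delta>' \<and> \<delta>' \<longlonglongrightarrow> 0 \<and>
     (\<forall>j. infdist 0 (subdifferential (aug_lagrangian Y x c t (\<sigma> j) (y j) (z j))
                       (d (Suc j), u (Suc j)))
            \<le> \<delta>' j / \<sigma> j * norm ((y (Suc j), z (Suc j)) - (y j, z j)))"

lemma continuous_on_aug_lagrangian: "continuous_on A (aug_lagrangian Y x c t \<sigma> y z)"
  unfolding aug_lagrangian_def l1_norm_def case_prod_beta
  by (intro continuous_intros
        continuous_on_compose2[OF matrix_vector_mult_linear_continuous_on[of UNIV "transpose Y"]])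
     auto

lemma completing_square_bound:
  fixes z w :: "'a::real_inner"
  assumes "\<sigma> > 0"
  shows "- ((norm z)\<^sup>2 / (2 * \<sigma>)) \<le> z \<bullet> w + \<sigma> / 2 * (norm w)\<^sup>2"
proof -
  have "0 \<le> (norm (z + \<sigma> *\<^sub>R w))\<^sup>2 / (2 * \<sigma>)" using assms by simp
  also have "(norm (z + \<sigma> *\<^sub>R w))\<^sup>2 = (norm z)\<^sup>2 + 2 * \<sigma> * (z \<bullet> w) + \<sigma>\<^sup>2 * (norm w)\<^sup>2"
    unfolding power2_norm_eq_inner
    by (simp add: inner_add_left inner_add_right inner_commute algebra_simps power2_eq_square)
  finally show ?thesis using assms by (simp add: field_simps power2_eq_square)
qed

lemma norm_le_l1_norm: "norm u \<le> l1_norm u"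
  unfolding l1_norm_def by (rule norm_le_l1_cart)

lemma aug_lagrangian_lower_bound:
  assumes "\<sigma> > 0"
  shows "(norm d)\<^sup>2 / 2 + t * l1_norm u - y\<^sup>2 / (2 * \<sigma>) - (norm z)\<^sup>2 / (2 * \<sigma>)
           \<le> aug_lagrangian Y x c t \<sigma> y z (d, u)"
  using completing_square_bound[OF assms, of y "d \<bullet> x"]
    completing_square_bound[OF assms, of z "transpose Y *v d + c - u"]
  unfolding aug_lagrangian_def by simp

lemma aug_lagrangian_min_attained:
  fixes Y :: "real ^ 'p ^ 'n"
  assumes "\<sigma> > 0" "t > 0"
  shows "\<exists>w. aug_lagrangian Y x c t \<sigma> y z w = (INF v. aug_lagrangian Y x c t \<sigma> y z v)
           \<and> (\<forall>v. aug_lagrangian Y x c t \<sigma> y z w \<le> aug_lagrangian Y x c t \<sigma> y z v)"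
proof -
  let ?f = "aug_lagrangian Y x c t \<sigma> y z"
  define C where "C = y\<^sup>2 / (2 * \<sigma>) + (norm z)\<^sup>2 / (2 * \<sigma>)"
  define M where "M = \<bar>?f (0, 0) + C\<bar>"
  define S where "S = (cball (0::real^'n) (2 * M + 1)) \<times> (cball (0::real^'p) (M / t))"
  have lb: "(norm d)\<^sup>2 / 2 + t * l1_norm u - C \<le> ?f (d, u)" for d u
    using aug_lagrangian_lower_bound[OF assms(1), where d = d and u = u and Y = Y]
    unfolding C_def by (simp add: algebra_simps)
  have l1: "0 \<le> l1_norm u" for u :: "real^'p"
    using norm_le_l1_norm[of u] norm_ge_zero[of u] by linarith
  have "compact S" unfolding S_def by (intro compact_Times compact_cball)
  moreover have "(0, 0) \<in> S" unfolding S_def M_def using assms by simp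
  ultimately obtain w where w: "w \<in> S" "\<And>v. v \<in> S \<Longrightarrow> ?f w \<le> ?f v"
    using continuous_attains_inf[OF _ _ continuous_on_aug_lagrangian, of S] by (metis empty_iff)
  have le: "?f w \<le> ?f v" for v
  proof (cases "v \<in> S")
    case False
    obtain d u where v: "v = (d, u)" by force
    have "?f (0, 0) \<le> ?f v"
    proof (rule ccontr)
      assume "\<not> ?thesis"
      then have *: "(norm d)\<^sup>2 / 2 + t * l1_norm u \<le> M"
        using lb[of d u] unfolding v M_def by linarith
      have a: "0 \<le> (norm d)\<^sup>2 / 2" "0 \<le> t * l1_norm u" using assms l1[of u] by auto
      have "t * norm u \<le> t * l1_norm u" using assms norm_le_l1_norm[of u] by simp
      then have "t * norm u \<le> M" using a * by linarith
      then have "norm u \<le> M / t" using assms by (simp add: field_simps)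
      moreover have "norm d \<le> 2 * M + 1"
      proof -
        have "0 \<le> (norm d - 1)\<^sup>2" by simp
        then have "2 * norm d \<le> (norm d)\<^sup>2 + 1" by (simp add: power2_eq_square algebra_simps)
        then show ?thesis using a * by argo
      qed
      ultimately show False using False unfolding v S_def by simp
    qed
    then show ?thesis using w(2)[OF \<open>(0, 0) \<in> S\<close>] by linarith
  qed (use w in auto)
  moreover from le have "?f w = (INF v. ?f v)"
    by (intro antisym cINF_greatest cINF_lower bdd_belowI2[where m = "?f w"]) auto
  ultimately show ?thesis by blast
qed

lemma matrix_vector_inner: "(Y *v q) \<bullet> e = q \<bullet> (transpose Y *v e)" for Y :: "real ^ 'p ^ 'n"
  using dot_lmul_matrix[of e Y q] by (simp add: inner_commute)

lemma subdifferential_aug_lagrangian_nonempty: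
  fixes Y :: "real ^ 'p ^ 'n"
  assumes "\<sigma> > 0" "t > 0"
  shows "subdifferential (aug_lagrangian Y x c t \<sigma> y z) w \<noteq> {}"
proof -
  obtain d u where w: "w = (d, u)" by force
  define r where "r = transpose Y *v d + c - u"
  define a where "a = d \<bullet> x"
  define s :: "real^'p" where "s = (\<chi> i. sgn (u $ i))"
  define g where "g = (d + (y + \<sigma> * a) *\<^sub>R x + Y *v (z + \<sigma> *\<^sub>R r), t *\<^sub>R s - (z + \<sigma> *\<^sub>R r))"
  have sq: "(norm p)\<^sup>2 / 2 + p \<bullet> (q - p) \<le> (norm q)\<^sup>2 / 2" for p q :: "'b::real_inner"
  proof -
    have "0 \<le> (norm (q - p))\<^sup>2" by simp
    then show ?thesis unfolding power2_norm_eq_inner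
      by (simp add: inner_diff_left inner_diff_right inner_commute algebra_simps)
  qed
  have "aug_lagrangian Y x c t \<sigma> y z w + g \<bullet> (v - w) \<le> aug_lagrangian Y x c t \<sigma> y z v" for v
  proof -
    obtain d' u' where v: "v = (d', u')" by force
    define r' where "r' = transpose Y *v d' + c - u'"
    define a' where "a' = d' \<bullet> x"
    have rr: "r' - r = transpose Y *v (d' - d) - (u' - u)"
      unfolding r_def r'_def by (simp add: matrix_vector_mult_diff_distrib)
    have "g \<bullet> (v - w) = d \<bullet> (d' - d) + (y + \<sigma> * a) * (a' - a)
        + (z + \<sigma> *\<^sub>R r) \<bullet> (transpose Y *v (d' - d)) + t * (s \<bullet> (u' - u)) - (z + \<sigma> *\<^sub>R r) \<bullet> (u' - u)"
      unfolding g_def v w a_def a'_def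
      by (simp add: inner_add_left inner_diff_left matrix_vector_inner inner_commute[of x] del: inner_diff_right)
    also have "\<dots> = d \<bullet> (d' - d) + (y + \<sigma> * a) * (a' - a)
        + (z + \<sigma> *\<^sub>R r) \<bullet> (r' - r) + t * (s \<bullet> (u' - u))"
      unfolding rr by (simp add: inner_diff_right)
    also have "\<dots> = d \<bullet> (d' - d) + y * (a' - a) + z \<bullet> r' - z \<bullet> r + \<sigma> * (a \<bullet> (a' - a))
        + \<sigma> * (r \<bullet> (r' - r)) + t * (s \<bullet> (u' - u))"
      by (simp add: inner_add_left inner_diff_right algebra_simps)
    finally have g: "g \<bullet> (v - w) = \<dots>" .
    have "l1_norm u + s \<bullet> (u' - u) \<le> l1_norm u'"
      unfolding l1_norm_def inner_vec_def s_def sum.distrib[symmetric]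
      by (intro sum_mono) (auto simp: sgn_if)
    then have 1: "t * l1_norm u + t * (s \<bullet> (u' - u)) \<le> t * l1_norm u'"
      using assms by (metis distrib_left mult_le_cancel_left_pos)
    have 2: "\<sigma> / 2 * (norm r)\<^sup>2 + \<sigma> * (r \<bullet> (r' - r)) \<le> \<sigma> / 2 * (norm r')\<^sup>2"
      using mult_left_mono[OF sq[of r r'], of \<sigma>] assms by (simp add: distrib_left)
    have 3: "\<sigma> / 2 * a\<^sup>2 + \<sigma> * (a \<bullet> (a' - a)) \<le> \<sigma> / 2 * a'\<^sup>2"
      using mult_left_mono[OF sq[of a a'], of \<sigma>] assms by (simp add: distrib_left)
    have 4: "y * (a' - a) = y * a' - y * a" by (simp add: algebra_simps)
    show ?thesis
      unfolding g using 1 2 3 4 sq[of d d']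
      unfolding v w aug_lagrangian_def prod.case r_def[symmetric] r'_def[symmetric]
        a_def[symmetric] a'_def[symmetric]
      by linarith
  qed
  then show ?thesis unfolding subdifferential_def by blast
qed

lemma kkt_set_nonempty:
  fixes Y :: "real ^ 'p ^ 'n"
  assumes "norm x = 1" "t > 0"
  shows "kkt_set Y x c t \<noteq> {}"
proof -
  txt \<open>A multiplier is found by minimizing the dual objective over the box, with the
    scalar multiplier eliminated.\<close>
  define Q where "Q e = Y *v e - (x \<bullet> (Y *v e)) *\<^sub>R x" for e
  define H where "H e = (norm (Q e))\<^sup>2 / 2 - c \<bullet> e" for e
  define B :: "(real^'p) set" where "B = cbox (\<chi> i. - t) (\<chi> i. t)"
  have B: "e \<in> B \<longleftrightarrow> (\<forall>i. \<bar>e $ i\<bar> \<le> t)" for e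
    unfolding B_def mem_box_cart by (auto simp: abs_le_iff minus_le_iff)
  have xx: "x \<bullet> x = 1" using assms(1) by (simp add: norm_eq_1)
  have "0 \<in> B" using assms B by simp
  moreover have "continuous_on B H" unfolding H_def Q_def
    by (intro continuous_intros
          continuous_on_compose2[OF matrix_vector_mult_linear_continuous_on[of UNIV Y]]) auto
  ultimately obtain z where z: "z \<in> B" "\<And>e. e \<in> B \<Longrightarrow> H z \<le> H e"
    using continuous_attains_inf[of B H] compact_cbox unfolding B_def by (metis empty_iff)
  define y where "y = - (x \<bullet> (Y *v z))"
  define d where "d = - Q z"
  define u where "u = transpose Y *v d + c"
  have "x \<bullet> d = 0" unfolding d_def Q_def by (simp add: inner_diff_right xx)
  then have dx: "d \<bullet> x = 0" by (simp add: inner_commute)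
  have VI: "u \<bullet> (z' - z) \<le> 0" if "z' \<in> B" for z'
  proof -
    define e where "e = z' - z"
    have Qz: "Q z \<bullet> Q e = - ((transpose Y *v d) \<bullet> e)"
    proof -
      have "d \<bullet> Q e = d \<bullet> (Y *v e)" unfolding Q_def using dx by (simp add: inner_diff_right)
      then show ?thesis unfolding d_def using matrix_vector_inner[of Y e "- Q z"]
        by (simp add: inner_commute)
    qed
    have H: "H (z + s *\<^sub>R e) = H z - s * (u \<bullet> e) + s\<^sup>2 / 2 * (norm (Q e))\<^sup>2" for s
    proof -
      have "Q (z + s *\<^sub>R e) = Q z + s *\<^sub>R Q e" unfolding Q_def
        by (simp add: matrix_vector_right_distrib matrix_vector_mult_scaleR inner_add_right algebra_simps)
      then have "(norm (Q (z + s *\<^sub>R e)))\<^sup>2 = (norm (Q z))\<^sup>2 + 2 * s * (Q z \<bullet> Q e) + s\<^sup>2 * (norm (Q e))\<^sup>2"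
        unfolding power2_norm_eq_inner
        by (simp add: inner_add_left inner_add_right inner_commute algebra_simps power2_eq_square)
      then show ?thesis unfolding H_def Qz u_def
        by (simp add: inner_add_left inner_add_right algebra_simps)
    qed
    have "u \<bullet> e \<le> s / 2 * (norm (Q e))\<^sup>2" if s: "0 < s" "s \<le> 1" for s
    proof -
      have "convex B" unfolding B_def by (rule convex_box)
      then have "(1 - s) *\<^sub>R z + s *\<^sub>R z' \<in> B" using s z(1) \<open>z' \<in> B\<close> convexD_alt by fastforce
      then have "z + s *\<^sub>R e \<in> B" unfolding e_def by (simp add: algebra_simps)
      from z(2)[OF this] have "s * (u \<bullet> e) \<le> s * (s / 2 * (norm (Q e))\<^sup>2)"
        unfolding H by (simp add: power2_eq_square)
      then show ?thesis using s by simp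
    qed
    then have "eventually (\<lambda>s. u \<bullet> e \<le> s / 2 * (norm (Q e))\<^sup>2) (at_right 0)"
      unfolding eventually_at_right_field by (intro exI[of _ 1]) auto
    moreover have "((\<lambda>s::real. s / 2 * (norm (Q e))\<^sup>2) \<longlongrightarrow> 0 / 2 * (norm (Q e))\<^sup>2) (at_right 0)"
      by (intro tendsto_intros) auto
    ultimately have "u \<bullet> e \<le> 0 / 2 * (norm (Q e))\<^sup>2"
      by (intro tendsto_lowerbound) auto
    then show ?thesis unfolding e_def by simp
  qed
  define g where "g = (1 / t) *\<^sub>R z"
  have "g \<in> subdifferential l1_norm u"
  proof -
    define z' :: "real^'p" where "z' = (\<chi> i. t * sgn (u $ i))"
    have "z' \<in> B" unfolding B z'_def using assms by (auto simp: sgn_if)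
    moreover have "u \<bullet> z' = t * l1_norm u"
      unfolding inner_vec_def l1_norm_def z'_def sum_distrib_left
      by (intro sum.cong) (auto simp: sgn_if)
    ultimately have "t * l1_norm u \<le> u \<bullet> z" using VI[of z'] by (simp add: inner_diff_right)
    then have 1: "l1_norm u \<le> g \<bullet> u"
      unfolding g_def using assms by (simp add: field_simps inner_commute)
    have 2: "g \<bullet> v \<le> l1_norm v" for v
    proof -
      have "g $ i * v $ i \<le> \<bar>v $ i\<bar>" for i
      proof -
        have "\<bar>g $ i\<bar> \<le> 1" using z(1) assms unfolding B g_def by (simp add: field_simps)
        then have "\<bar>g $ i * v $ i\<bar> \<le> 1 * \<bar>v $ i\<bar>"
          unfolding abs_mult by (intro mult_right_mono) auto
        then show ?thesis by linarith
      qed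
      then show ?thesis unfolding inner_vec_def l1_norm_def by (auto intro: sum_mono)
    qed
    have "l1_norm u + g \<bullet> (v - u) \<le> l1_norm v" for v
      using 1 2[of u] 2[of v] by (simp add: inner_diff_right)
    then show ?thesis unfolding subdifferential_def by blast
  qed
  moreover have "z = t *\<^sub>R g" unfolding g_def using assms by simp
  moreover have "d + y *\<^sub>R x + Y *v z = 0" unfolding d_def Q_def y_def by simp
  ultimately have "(d, u, y, z) \<in> kkt_set Y x c t"
    unfolding kkt_set_def using dx u_def by auto
  then show ?thesis by blast
qed

end

theory Submission
  imports Defs
begin

text \<open>The method is an inexact proximal point iteration on the multipliers \<open>\<mu> = (y, z)\<close>. The exact
  minimizer of a subproblem and its updated multiplier satisfy all KKT conditions except for the
  residual \<open>(\<mu>h - \<mu>) / \<sigma>\<close> in the constraints; monotonicity of the KKT system then gives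
  \<open>\<bar>\<mu>h - \<mu>s\<bar>\<^sup>2 + \<bar>\<mu>h - \<mu>\<bar>\<^sup>2 + 2 \<sigma> \<bar>dh - ds\<bar>\<^sup>2 \<le> \<bar>\<mu> - \<mu>s\<bar>\<^sup>2\<close> for every KKT point.
  As the gap in the subproblem dominates \<open>\<bar>d - dh\<bar>\<^sup>2 / 2 + \<bar>\<mu>' - \<mu>h\<bar>\<^sup>2 / (2 \<sigma>)\<close>, with \<open>d\<close>, \<open>\<mu>'\<close>
  the computed point and its multiplier, criterion (A) makes \<open>\<bar>\<mu> - \<mu>s\<bar>\<close> convergent along the
  iteration and \<open>d\<close> converge to \<open>ds\<close>. For the rate, once \<open>uh\<close> is close to the optimal \<open>us\<close>, the vector
  \<open>zh\<close> lies in the polyhedron \<open>t \<partial>\<bar>us\<bar>\<^sub>1\<close>, so Hoffman's bound estimates the distance of \<open>\<mu>h\<close> to the optimal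
  multipliers by \<open>\<bar>dh - ds\<bar>\<close>, and the monotonicity in turn estimates \<open>\<bar>dh - ds\<bar>\<close> by the residual.
  The distance to the KKT points is therefore reduced by a factor of order \<open>1 / \<sigma> + \<delta>\<close>.\<close>

section \<open>An error bound for polyhedra\<close>

text \<open>A vector of \<open>C\<close> in the kernel of \<open>M\<close> may be tested against
  itself, so v . v <= 0 and v = 0. Hence the norm of \<open>M v\<close> has a positive minimum over
  the compact set of unit vectors in \<open>C\<close>, and homogeneity extends the bound to all of
  \<open>C\<close>.\<close>

lemma polyhedral_cone_error_bound:
  fixes M :: "'a::euclidean_space \<Rightarrow> 'b::real_normed_vector"
  assumes "linear M"
    and C: "C = {v. (\<forall>a\<in>A. a \<bullet> v \<le> 0) \<and> (\<forall>w. (\<forall>a\<in>A. a \<bullet> w \<le> 0) \<and> M w = 0 \<longrightarrow> v \<bullet> w \<le> 0)}"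
  shows "\<exists>\<gamma>>0. \<forall>v\<in>C. \<gamma> * norm v \<le> norm (M v)"
proof -
  interpret M: linear M by fact
  have contM: "continuous_on S M" for S
    using \<open>linear M\<close> by (simp add: linear_continuous_on linear_conv_bounded_linear)
  have "C = (\<Inter>a\<in>A. {v. a \<bullet> v \<le> 0}) \<inter> (\<Inter>w\<in>{w. (\<forall>a\<in>A. a \<bullet> w \<le> 0) \<and> M w = 0}. {v. w \<bullet> v \<le> 0})"
    unfolding C by (auto simp: inner_commute)
  then have "closed C"
    by (auto intro!: closed_Int closed_INT closed_halfspace_le)
  define S where "S = sphere 0 1 \<inter> C"
  have "compact S" unfolding S_def using \<open>closed C\<close> by (intro compact_Int_closed) auto
  have nz: "M v \<noteq> 0" if "v \<in> C" "v \<noteq> 0" for v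
  proof
    assume "M v = 0"
    then have "v \<bullet> v \<le> 0" using that(1) unfolding C by blast
    then show False using that(2) by (metis inner_gt_zero_iff not_less)
  qed
  have "\<exists>\<gamma>>0. \<forall>v\<in>S. \<gamma> \<le> norm (M v)"
  proof (cases "S = {}")
    case True
    then show ?thesis by (intro exI[of _ 1]) auto
  next
    case False
    then obtain v where v: "v \<in> S" "\<forall>w\<in>S. norm (M v) \<le> norm (M w)"
      using continuous_attains_inf[OF \<open>compact S\<close> False continuous_on_norm[OF contM]] by blast
    then have "v \<in> C" "v \<noteq> 0" unfolding S_def by auto
    then have "M v \<noteq> 0" by (rule nz)
    then show ?thesis using v(2) by (intro exI[of _ "norm (M v)"]) auto
  qed
  then obtain \<gamma> where \<gamma>: "\<gamma> > 0" "\<And>v. v \<in> S \<Longrightarrow> \<gamma> \<le> norm (M v)" by blast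
  have "\<gamma> * norm v \<le> norm (M v)" if "v \<in> C" for v
  proof (cases "v = 0")
    case False
    define w where "w = (1 / norm v) *\<^sub>R v"
    have "w \<in> C" using that unfolding C w_def
      by (auto simp: mult_le_0_iff divide_le_0_iff)
    then have "w \<in> S" unfolding S_def w_def using False by simp
    from \<gamma>(2)[OF this] show ?thesis
      using False unfolding w_def by (simp add: M.scaleR field_simps)
  qed (simp add: M.zero)
  then show ?thesis using \<gamma>(1) by blast
qed

text \<open>If \<open>p\<close> is the point of the polyhedron closest to \<open>q\<close>, then \<open>q - p\<close> lies in the cone of
  \<open>polyhedral_cone_error_bound\<close> that belongs to the constraints active at \<open>p\<close>, and there are
  only finitely many active sets.\<close>

lemma hoffman_error_bound:
  fixes M :: "'a::euclidean_space \<Rightarrow> 'b::real_normed_vector" and F :: "('a \<times> real) set"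
  assumes "linear M" "finite F" "\<forall>(a, \<beta>)\<in>F. a \<bullet> p0 \<le> \<beta>" "M p0 = b"
  shows "\<exists>\<kappa>\<ge>0. \<forall>q. (\<forall>(a, \<beta>)\<in>F. a \<bullet> q \<le> \<beta>) \<longrightarrow>
           (\<exists>p. (\<forall>(a, \<beta>)\<in>F. a \<bullet> p \<le> \<beta>) \<and> M p = b \<and> norm (q - p) \<le> \<kappa> * norm (M q - b))"
proof -
  interpret M: linear M by fact
  define S where "S = {p. (\<forall>(a, \<beta>)\<in>F. a \<bullet> p \<le> \<beta>) \<and> M p = b}"
  have S_eq: "S = (\<Inter>(a, \<beta>)\<in>F. {p. a \<bullet> p \<le> \<beta>}) \<inter> M -` {b}"
    unfolding S_def by auto
  have "continuous_on UNIV M"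
    using \<open>linear M\<close> by (simp add: linear_continuous_on linear_conv_bounded_linear)
  then have "closed (M -` {b})" by (simp add: closed_vimage)
  then have "closed S" unfolding S_eq
    by (intro closed_Int closed_INT) (auto intro: closed_halfspace_le)
  have "convex (M -` {b})" using \<open>linear M\<close> by (simp add: convex_linear_vimage)
  then have "convex S" unfolding S_eq
    by (intro convex_Int convex_INT) (auto intro: convex_halfspace_le)
  have "S \<noteq> {}" using assms(3,4) unfolding S_def by blast
  define C where "C J = {v. (\<forall>a\<in>fst ` J. a \<bullet> v \<le> 0) \<and>
      (\<forall>w. (\<forall>a\<in>fst ` J. a \<bullet> w \<le> 0) \<and> M w = 0 \<longrightarrow> v \<bullet> w \<le> 0)}" for J :: "('a \<times> real) set"
  have "\<forall>J. \<exists>\<gamma>>0. \<forall>v\<in>C J. \<gamma> * norm v \<le> norm (M v)"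
    using polyhedral_cone_error_bound[OF \<open>linear M\<close> C_def] by blast
  then obtain \<gamma> where \<gamma>: "\<And>J. \<gamma> J > 0" "\<And>J v. v \<in> C J \<Longrightarrow> \<gamma> J * norm v \<le> norm (M v)"
    by metis
  \<comment> \<open>One constant for all q: the sum over all subsets of \<open>F\<close> dominates 1
    / \<open>\<gamma> J\<close> for every possible active set \<open>J\<close>.\<close>
  define \<kappa> where "\<kappa> = (\<Sum>J\<in>Pow F. 1 / \<gamma> J)"
  have "\<kappa> \<ge> 0" unfolding \<kappa>_def using \<gamma>(1) by (intro sum_nonneg) (simp add: less_imp_le)
  moreover have "\<exists>p. (\<forall>(a, \<beta>)\<in>F. a \<bullet> p \<le> \<beta>) \<and> M p = b \<and> norm (q - p) \<le> \<kappa> * norm (M q - b)"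
    if q: "\<forall>(a, \<beta>)\<in>F. a \<bullet> q \<le> \<beta>" for q
  proof -
    define p where "p = closest_point S q"
    have "p \<in> S" unfolding p_def using \<open>closed S\<close> \<open>S \<noteq> {}\<close> by (rule closest_point_in_set)
    then have p: "\<And>a \<beta>. (a, \<beta>) \<in> F \<Longrightarrow> a \<bullet> p \<le> \<beta>" "M p = b" unfolding S_def by auto
    define J where "J = {(a, \<beta>) \<in> F. a \<bullet> p = \<beta>}"
    \<comment> \<open>A short move from p along w stays in \<open>S\<close>: active constraints do
      not increase, inactive ones have slack, and \<open>M\<close> is unchanged. The obtuse angle
      property of the projection then gives the sign.\<close>
    have "(q - p) \<bullet> w \<le> 0" if w: "\<forall>a\<in>fst ` J. a \<bullet> w \<le> 0" "M w = 0" for w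
    proof -
      have "\<forall>\<^sub>F s in at_right 0. case k of (a, \<beta>) \<Rightarrow> a \<bullet> (p + s *\<^sub>R w) \<le> \<beta>" if "k \<in> F" for k
      proof -
        obtain a \<beta> where k: "k = (a, \<beta>)" by force
        show ?thesis
        proof (cases "a \<bullet> p = \<beta>")
          case True
          then have "a \<bullet> w \<le> 0" using w(1) that unfolding J_def k by force
          then show ?thesis unfolding k using True
            by (auto simp: eventually_at_right_field inner_add_right mult_le_0_iff intro!: exI[of _ 1])
        next
          case False
          then have "a \<bullet> p < \<beta>" using p(1)[of a \<beta>] that unfolding k by simp
          moreover have "((\<lambda>s. a \<bullet> (p + s *\<^sub>R w)) \<longlongrightarrow> a \<bullet> (p + 0 *\<^sub>R w)) (at_right 0)"
            by (intro tendsto_intros)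
          ultimately have "\<forall>\<^sub>F s in at_right 0. a \<bullet> (p + s *\<^sub>R w) < \<beta>"
            by (intro order_tendstoD(2)) auto
          then show ?thesis unfolding k by (auto elim: eventually_mono)
        qed
      qed
      then have "\<forall>\<^sub>F s in at_right (0::real). \<forall>k\<in>F. case k of (a, \<beta>) \<Rightarrow> a \<bullet> (p + s *\<^sub>R w) \<le> \<beta>"
        using \<open>finite F\<close> by (simp add: eventually_ball_finite)
      moreover have "\<forall>\<^sub>F s in at_right (0::real). s > 0" by (rule eventually_at_right_less)
      ultimately have "\<forall>\<^sub>F s in at_right (0::real).
          (\<forall>k\<in>F. case k of (a, \<beta>) \<Rightarrow> a \<bullet> (p + s *\<^sub>R w) \<le> \<beta>) \<and> s > 0"
        by (rule eventually_conj)
      then obtain s :: real where s: "\<forall>k\<in>F. case k of (a, \<beta>) \<Rightarrow> a \<bullet> (p + s *\<^sub>R w) \<le> \<beta>" "s > 0"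
        using eventually_happens' trivial_limit_at_right_real by blast
      then have "p + s *\<^sub>R w \<in> S" unfolding S_def using p(2) w(2)
        by (auto simp: M.add M.scaleR)
      from closest_point_dot[OF \<open>convex S\<close> \<open>closed S\<close> this, of q]
      have "s * ((q - p) \<bullet> w) \<le> 0" unfolding p_def[symmetric] by simp
      then show ?thesis using s(2) by (simp add: mult_le_0_iff)
    qed
    moreover have "\<forall>a\<in>fst ` J. a \<bullet> (q - p) \<le> 0"
      unfolding J_def using q by (auto simp: inner_diff_right)
    ultimately have "q - p \<in> C J" unfolding C_def by blast
    then have "norm (q - p) \<le> 1 / \<gamma> J * norm (M (q - p))"
      using \<gamma>(1)[of J] \<gamma>(2)[of "q - p" J] by (simp add: field_simps)
    also have "\<dots> \<le> \<kappa> * norm (M q - b)"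
    proof -
      have "J \<in> Pow F" unfolding J_def by auto
      then have "1 / \<gamma> J \<le> \<kappa>" unfolding \<kappa>_def using \<gamma>(1) \<open>finite F\<close>
        by (intro member_le_sum) (auto simp: less_imp_le)
      from mult_right_mono[OF this norm_ge_zero, of "M q - b"] show ?thesis by (simp add: M.diff p(2))
    qed
    finally show ?thesis using p by blast
  qed
  ultimately show ?thesis by blast
qed

section \<open>Stationary points of the Lagrangian\<close>

text \<open>The l1 norm is separable, so the inequality splits into coordinates. For fixed
  \<open>u\<close> the result is a system of linear constraints on \<open>z\<close>, the form to
  which Hoffman's bound applies.\<close>

lemma l1_subgradient_iff:
  fixes u z :: "real ^ 'p"
  assumes "t > 0"
  shows "(\<forall>v. t * l1_norm u + z \<bullet> (v - u) \<le> t * l1_norm v)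
     \<longleftrightarrow> (\<forall>i. \<bar>z $ i\<bar> \<le> t \<and> z $ i * u $ i = t * \<bar>u $ i\<bar>)" (is "?L \<longleftrightarrow> ?R")
proof
  assume L: ?L
  show ?R
  proof
    fix i
    have *: "t * \<bar>u $ i\<bar> + z $ i * s \<le> t * \<bar>u $ i + s\<bar>" for s
    proof -
      have "l1_norm (u + axis i s) = \<bar>u $ i + s\<bar> + (\<Sum>k\<in>UNIV - {i}. \<bar>u $ k\<bar>)"
        unfolding l1_norm_def by (subst sum.remove[of _ i]) (auto simp: axis_def intro!: sum.cong)
      moreover have "l1_norm u = \<bar>u $ i\<bar> + (\<Sum>k\<in>UNIV - {i}. \<bar>u $ k\<bar>)"
        unfolding l1_norm_def by (subst sum.remove[of _ i]) auto
      moreover have "z \<bullet> (u + axis i s - u) = z $ i * s" by (simp add: inner_axis)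
      ultimately show ?thesis
        using L[rule_format, of "u + axis i s"] by (simp add: distrib_left)
    qed
    have tri: "t * \<bar>u $ i + s\<bar> \<le> t * \<bar>u $ i\<bar> + t * \<bar>s\<bar>" for s
      using assms mult_left_mono[OF abs_triangle_ineq[of "u $ i" s], of t] by (simp add: distrib_left)
    \<comment> \<open>The increments 1 and -1 bound the coordinate of \<open>z\<close>; doubling and
      cancelling the coordinate of \<open>u\<close> give the two halves of the equation.\<close>
    have "\<bar>z $ i\<bar> \<le> t"
      using *[of 1] tri[of 1] *[of "-1"] tri[of "-1"] by auto
    moreover have "z $ i * u $ i = t * \<bar>u $ i\<bar>"
      using *[of "u $ i"] tri[of "u $ i"] *[of "- u $ i"] by auto
    ultimately show "\<bar>z $ i\<bar> \<le> t \<and> z $ i * u $ i = t * \<bar>u $ i\<bar>" ..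
  qed
next
  assume R: ?R
  show ?L
  proof
    fix v
    have "t * \<bar>u $ i\<bar> + z $ i * (v $ i - u $ i) \<le> t * \<bar>v $ i\<bar>" for i
    proof -
      have "z $ i * v $ i \<le> \<bar>z $ i\<bar> * \<bar>v $ i\<bar>" by (metis abs_ge_self abs_mult)
      also have "\<dots> \<le> t * \<bar>v $ i\<bar>" using R by (intro mult_right_mono) auto
      finally show ?thesis using R by (simp add: right_diff_distrib)
    qed
    then show "t * l1_norm u + z \<bullet> (v - u) \<le> t * l1_norm v"
      unfolding l1_norm_def inner_vec_def sum_distrib_left
      by (simp add: sum.distrib[symmetric] sum_mono)
  qed
qed

text \<open>The conditions on \<open>z\<close> say \<open>z \<in> t \<partial>\<bar>u\<bar>\<^sub>1\<close>; the constraints of the problem are not included.\<close>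

definition stationary ::
  "real ^ 'p ^ 'n \<Rightarrow> real ^ 'n \<Rightarrow> real \<Rightarrow> real ^ 'n \<Rightarrow> real ^ 'p \<Rightarrow> real \<Rightarrow> real ^ 'p \<Rightarrow> bool" where
  "stationary Y x t d u y z \<longleftrightarrow> d + y *\<^sub>R x + Y *v z = 0 \<and>
     (\<forall>i. \<bar>z $ i\<bar> \<le> t \<and> z $ i * u $ i = t * \<bar>u $ i\<bar>)"

lemma stationary_subgradient:
  assumes "stationary Y x t d u y z" "t > 0"
  shows "t * l1_norm u + z \<bullet> (v - u) \<le> t * l1_norm v"
  using assms l1_subgradient_iff[OF assms(2), of u z] unfolding stationary_def by blast

lemma stationary_inner:
  fixes Y :: "real ^ 'p ^ 'n"
  assumes "stationary Y x t d u y z"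
  shows "d \<bullet> e + y * (e \<bullet> x) + z \<bullet> (transpose Y *v e) = 0"
proof -
  have "(d + y *\<^sub>R x + Y *v z) \<bullet> e = 0" using assms unfolding stationary_def by simp
  then show ?thesis by (simp add: inner_add_left matrix_vector_inner inner_commute[of x])
qed

lemma mem_kkt_set_iff:
  fixes Y :: "real ^ 'p ^ 'n"
  assumes "t > 0"
  shows "(d, u, y, z) \<in> kkt_set Y x c t
     \<longleftrightarrow> stationary Y x t d u y z \<and> transpose Y *v d + c = u \<and> d \<bullet> x = 0"
proof -
  have "z \<in> (\<lambda>g. t *\<^sub>R g) ` subdifferential l1_norm u
     \<longleftrightarrow> (\<forall>v. t * l1_norm u + z \<bullet> (v - u) \<le> t * l1_norm v)"
  proof
    assume "z \<in> (\<lambda>g. t *\<^sub>R g) ` subdifferential l1_norm u"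
    then obtain g where g: "z = t *\<^sub>R g" "\<And>v. l1_norm u + g \<bullet> (v - u) \<le> l1_norm v"
      unfolding subdifferential_def by blast
    show "\<forall>v. t * l1_norm u + z \<bullet> (v - u) \<le> t * l1_norm v"
      using mult_left_mono[OF g(2), of t] assms unfolding g(1) by (simp add: distrib_left)
  next
    assume *: "\<forall>v. t * l1_norm u + z \<bullet> (v - u) \<le> t * l1_norm v"
    have "l1_norm u + ((1 / t) *\<^sub>R z) \<bullet> (v - u) \<le> l1_norm v" for v
      using *[rule_format, of v] assms by (simp add: field_simps)
    then have "(1 / t) *\<^sub>R z \<in> subdifferential l1_norm u" unfolding subdifferential_def by blast
    then show "z \<in> (\<lambda>g. t *\<^sub>R g) ` subdifferential l1_norm u"
      using assms by (intro image_eqI[of _ _ "(1 / t) *\<^sub>R z"]) auto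
  qed
  then show ?thesis
    unfolding kkt_set_def stationary_def l1_subgradient_iff[OF assms] by auto
qed

text \<open>Adding the two subgradient inequalities gives 0 <= (z - z') . (u - u'). The difference
  of the gradient equations, paired with d - d', supplies the other terms. The multiplier
  differences are thereby paired with the difference of the constraint residuals.\<close>

lemma stationary_monotone:
  fixes Y :: "real ^ 'p ^ 'n"
  assumes "stationary Y x t d u y z" "stationary Y x t d' u' y' z'" "t > 0"
  shows "(norm (d - d'))\<^sup>2 + (y - y') * ((d - d') \<bullet> x)
     + (z - z') \<bullet> (transpose Y *v (d - d') - (u - u')) \<le> 0"
proof -
  have "0 \<le> (z - z') \<bullet> (u - u')"
    using stationary_subgradient[OF assms(1,3), of u'] stationary_subgradient[OF assms(2,3), of u]
    by (simp add: inner_diff_left inner_diff_right)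
  then show ?thesis
    using stationary_inner[OF assms(1), of "d - d'"] stationary_inner[OF assms(2), of "d - d'"]
    unfolding power2_norm_eq_inner
    by (simp add: inner_diff_left inner_diff_right left_diff_distrib)
qed

section \<open>Expansion of the augmented Lagrangian and first-order conditions\<close>

lemma half_norm_expand:
  fixes p q :: "'a::real_inner"
  shows "(norm q)\<^sup>2 / 2 = (norm p)\<^sup>2 / 2 + p \<bullet> (q - p) + (norm (q - p))\<^sup>2 / 2"
  unfolding power2_norm_eq_inner by (simp add: inner_diff_left inner_diff_right inner_commute field_simps)

text \<open>Everything but the l1 norm is quadratic, so the expansion about (d, u) is exact. Its
  linear part contains precisely the updated multipliers.\<close>

lemma aug_lagrangian_expand:
  fixes Y :: "real ^ 'p ^ 'n" and c :: "real ^ 'p"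
  defines "r \<equiv> \<lambda>(d, u). transpose Y *v d + c - u"
  shows "aug_lagrangian Y x c t \<sigma> y z (d', u') = aug_lagrangian Y x c t \<sigma> y z (d, u)
     + d \<bullet> (d' - d) + (y + \<sigma> * (d \<bullet> x)) * ((d' - d) \<bullet> x)
     + (z + \<sigma> *\<^sub>R r (d, u)) \<bullet> (transpose Y *v (d' - d))
     + (t * l1_norm u' - t * l1_norm u - (z + \<sigma> *\<^sub>R r (d, u)) \<bullet> (u' - u))
     + (norm (d' - d))\<^sup>2 / 2 + \<sigma> / 2 * ((d' - d) \<bullet> x)\<^sup>2
     + \<sigma> / 2 * (norm (transpose Y *v (d' - d) - (u' - u)))\<^sup>2"
proof -
  define R where "R = r (d, u)"
  define E where "E = transpose Y *v (d' - d) - (u' - u)"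
  define A where "A = d \<bullet> x"
  define B where "B = (d' - d) \<bullet> x"
  have r': "r (d', u') = R + E"
    unfolding R_def E_def r_def by (simp add: matrix_vector_mult_diff_distrib)
  have a': "d' \<bullet> x = A + B" unfolding A_def B_def by (simp add: inner_diff_left)
  have n: "(norm (R + E))\<^sup>2 = (norm R)\<^sup>2 + 2 * (R \<bullet> E) + (norm E)\<^sup>2"
    unfolding power2_norm_eq_inner by (simp add: inner_add_left inner_add_right inner_commute)
  have ex: "aug_lagrangian Y x c t \<sigma> y z (e, v) = (norm e)\<^sup>2 / 2 + t * l1_norm v
     + y * (e \<bullet> x) + z \<bullet> r (e, v) + \<sigma> / 2 * (e \<bullet> x)\<^sup>2 + \<sigma> / 2 * (norm (r (e, v)))\<^sup>2" for e v
    unfolding aug_lagrangian_def r_def by simp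
  have s: "(z + \<sigma> *\<^sub>R R) \<bullet> (transpose Y *v (d' - d)) - (z + \<sigma> *\<^sub>R R) \<bullet> (u' - u)
      = z \<bullet> E + \<sigma> * (R \<bullet> E)"
    unfolding E_def by (simp add: inner_add_left inner_diff_right algebra_simps)
  show ?thesis
    unfolding ex r' a' R_def[symmetric] E_def[symmetric] A_def[symmetric] B_def[symmetric] n
    using s half_norm_expand[of d' d] by (simp add: power2_eq_square inner_add_right field_simps)
qed

text \<open>Stationarity with the updated multipliers cancels the linear terms of the expansion and
  makes the l1 bracket nonnegative; the quadratic terms remain.\<close>

lemma aug_lagrangian_growth:
  fixes Y :: "real ^ 'p ^ 'n"
  assumes "stationary Y x t d u (y + \<sigma> * (d \<bullet> x)) (z + \<sigma> *\<^sub>R (transpose Y *v d + c - u))" "t > 0"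
  shows "aug_lagrangian Y x c t \<sigma> y z (d, u) + (norm (d' - d))\<^sup>2 / 2
       + \<sigma> / 2 * ((d' - d) \<bullet> x)\<^sup>2 + \<sigma> / 2 * (norm (transpose Y *v (d' - d) - (u' - u)))\<^sup>2
     \<le> aug_lagrangian Y x c t \<sigma> y z (d', u')"
  using stationary_inner[OF assms(1), of "d' - d"] stationary_subgradient[OF assms, of u']
  unfolding aug_lagrangian_expand[of Y x c t \<sigma> y z d' u' d u] by simp

lemma l1_norm_segment:
  fixes u e :: "real ^ 'p"
  assumes "0 \<le> s" "s \<le> 1"
  shows "l1_norm (u + s *\<^sub>R e) \<le> l1_norm u + s * (l1_norm (u + e) - l1_norm u)"
proof -
  have "\<bar>u $ i + s * e $ i\<bar> \<le> \<bar>u $ i\<bar> + s * (\<bar>u $ i + e $ i\<bar> - \<bar>u $ i\<bar>)" for i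
  proof -
    have "\<bar>u $ i + s * e $ i\<bar> = \<bar>(1 - s) * u $ i + s * (u $ i + e $ i)\<bar>"
      by (simp add: algebra_simps)
    also have "\<dots> \<le> \<bar>(1 - s) * u $ i\<bar> + \<bar>s * (u $ i + e $ i)\<bar>" by (rule abs_triangle_ineq)
    also have "\<dots> = (1 - s) * \<bar>u $ i\<bar> + s * \<bar>u $ i + e $ i\<bar>" using assms by (simp add: abs_mult)
    finally show ?thesis by (simp add: algebra_simps)
  qed
  then show ?thesis
    unfolding l1_norm_def by (simp add: sum_distrib_left sum.distrib[symmetric]
      sum_subtractf[symmetric] sum_mono)
qed

text \<open>Along a segment of length s the l1 norm is bounded by convexity and the remainder is of
  order s^2. Dividing by s and letting s tend to 0 leaves a variational inequality, which encodes
  both conditions.\<close>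

lemma aug_lagrangian_minimizer_stationary:
  fixes Y :: "real ^ 'p ^ 'n"
  assumes min: "\<And>v. aug_lagrangian Y x c t \<sigma> y z (d, u) \<le> aug_lagrangian Y x c t \<sigma> y z v" and "t > 0"
  shows "stationary Y x t d u (y + \<sigma> * (d \<bullet> x)) (z + \<sigma> *\<^sub>R (transpose Y *v d + c - u))"
proof -
  define yh where "yh = y + \<sigma> * (d \<bullet> x)"
  define zh where "zh = z + \<sigma> *\<^sub>R (transpose Y *v d + c - u)"
  define G where "G = d + yh *\<^sub>R x + Y *v zh"
  have VI: "0 \<le> G \<bullet> e + (t * l1_norm (u + f) - t * l1_norm u - zh \<bullet> f)" for e f
  proof -
    define a where "a = G \<bullet> e + (t * l1_norm (u + f) - t * l1_norm u - zh \<bullet> f)"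
    define b where "b = (norm e)\<^sup>2 / 2 + \<sigma> / 2 * (e \<bullet> x)\<^sup>2
      + \<sigma> / 2 * (norm (transpose Y *v e - f))\<^sup>2"
    have "0 \<le> a + s * b" if s: "0 < s" "s \<le> 1" for s
    proof -
      have "t * l1_norm (u + s *\<^sub>R f) - t * l1_norm u \<le> s * (t * l1_norm (u + f) - t * l1_norm u)"
        using mult_left_mono[OF l1_norm_segment[of s u f], of t] s \<open>t > 0\<close>
        by (simp add: algebra_simps)
      moreover have "0 \<le> d \<bullet> (s *\<^sub>R e) + yh * ((s *\<^sub>R e) \<bullet> x) + zh \<bullet> (transpose Y *v (s *\<^sub>R e))
         + (t * l1_norm (u + s *\<^sub>R f) - t * l1_norm u - zh \<bullet> (s *\<^sub>R f))
         + (norm (s *\<^sub>R e))\<^sup>2 / 2 + \<sigma> / 2 * ((s *\<^sub>R e) \<bullet> x)\<^sup>2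
         + \<sigma> / 2 * (norm (transpose Y *v (s *\<^sub>R e) - s *\<^sub>R f))\<^sup>2"
        using min[of "(d + s *\<^sub>R e, u + s *\<^sub>R f)"]
        unfolding aug_lagrangian_expand[of Y x c t \<sigma> y z "d + s *\<^sub>R e" "u + s *\<^sub>R f" d u]
          yh_def zh_def by simp
      moreover have "d \<bullet> (s *\<^sub>R e) + yh * ((s *\<^sub>R e) \<bullet> x) + zh \<bullet> (transpose Y *v (s *\<^sub>R e)) = s * (G \<bullet> e)"
        unfolding G_def
        by (simp add: inner_add_left matrix_vector_inner inner_commute[of x]
            matrix_vector_mult_scaleR distrib_left)
      moreover have "(norm (s *\<^sub>R e))\<^sup>2 / 2 + \<sigma> / 2 * ((s *\<^sub>R e) \<bullet> x)\<^sup>2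
         + \<sigma> / 2 * (norm (transpose Y *v (s *\<^sub>R e) - s *\<^sub>R f))\<^sup>2 = s * (s * b)"
      proof -
        have eq: "transpose Y *v (s *\<^sub>R e) - s *\<^sub>R f = s *\<^sub>R (transpose Y *v e - f)"
          by (simp add: matrix_vector_mult_scaleR scaleR_diff_right)
        show ?thesis unfolding eq b_def
          by (simp add: power_mult_distrib) (simp add: algebra_simps power2_eq_square)
      qed
      ultimately have "0 \<le> s * (a + s * b)"
        unfolding a_def by (simp add: algebra_simps)
      then show ?thesis using s by (simp add: zero_le_mult_iff)
    qed
    then have "\<forall>\<^sub>F s in at_right 0. 0 \<le> a + s * b"
      unfolding eventually_at_right_field by (intro exI[of _ 1]) auto
    moreover have "((\<lambda>s. a + s * b) \<longlongrightarrow> a + 0 * b) (at_right 0)" by (intro tendsto_intros)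
    ultimately have "0 \<le> a + 0 * b" by (intro tendsto_lowerbound) auto
    then show ?thesis unfolding a_def by simp
  qed
  \<comment> \<open>Variations of d alone force the gradient to vanish; variations of u alone give
    the subgradient inequality.\<close>
  have "G \<bullet> G \<le> 0" using VI[of "- G" 0] by simp
  then have "G = 0" by (metis inner_gt_zero_iff not_less)
  moreover have "\<forall>v. t * l1_norm u + zh \<bullet> (v - u) \<le> t * l1_norm v"
  proof
    fix v show "t * l1_norm u + zh \<bullet> (v - u) \<le> t * l1_norm v" using VI[of 0 "v - u"] by simp
  qed
  ultimately show ?thesis
    unfolding stationary_def l1_subgradient_iff[OF \<open>t > 0\<close>] G_def yh_def[symmetric] zh_def[symmetric]
    by blast
qed

section \<open>Optimality and uniqueness from a KKT point\<close>

lemma kkt_growth: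
  fixes Y :: "real ^ 'p ^ 'n"
  assumes "(d, u, y, z) \<in> kkt_set Y x c t" "feasible Y x c (d', u')" "t > 0"
  shows "objective t (d, u) + (norm (d' - d))\<^sup>2 / 2 \<le> objective t (d', u')"
proof -
  have *: "stationary Y x t d u y z" "transpose Y *v d + c = u" "d \<bullet> x = 0"
    using assms(1) unfolding mem_kkt_set_iff[OF assms(3)] by auto
  \<comment> \<open>Penalty parameter 0 turns the augmented Lagrangian into the ordinary one, whose
    multiplier terms vanish at feasible points.\<close>
  show ?thesis
    using aug_lagrangian_growth[of Y x t d u y 0 z c d' u'] assms(2,3) *
    unfolding aug_lagrangian_def objective_def feasible_def by simp
qed

text \<open>Uniqueness comes from the quadratic growth in d, which fixes d; the equality constraint
  then fixes u.\<close>

lemma kkt_optimal: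
  fixes Y :: "real ^ 'p ^ 'n"
  assumes "(d, u, y, z) \<in> kkt_set Y x c t" "t > 0"
  shows "optimal_solution Y x c t (d, u)" "optimal_solution Y x c t w \<Longrightarrow> w = (d, u)"
proof -
  have feas: "feasible Y x c (d, u)"
    using assms(1) unfolding mem_kkt_set_iff[OF assms(2)] feasible_def by auto
  have "objective t (d, u) \<le> objective t v" if "feasible Y x c v" for v
    using kkt_growth[OF assms(1) _ assms(2), of "fst v" "snd v"] that
    by simp (smt (verit) zero_le_power2 divide_nonneg_pos)
  then show opt: "optimal_solution Y x c t (d, u)"
    unfolding is_arg_min_linorder using feas by auto
  assume w: "optimal_solution Y x c t w"
  obtain d' u' where w_eq: "w = (d', u')" by force
  have "feasible Y x c w" "objective t w \<le> objective t (d, u)"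
    using w feas unfolding is_arg_min_linorder by auto
  then have "(norm (d' - d))\<^sup>2 / 2 \<le> 0"
    using kkt_growth[OF assms(1) _ assms(2), of d' u'] unfolding w_eq by linarith
  then have "d' = d" by simp
  then show "w = (d, u)" using \<open>feasible Y x c w\<close> feas unfolding w_eq feasible_def by auto
qed

section \<open>The error bound for KKT points\<close>

text \<open>Near \<open>us\<close> its nonzero coordinates keep their sign, which forces the same
  value t or -t in \<open>z\<close>. Where \<open>us\<close> vanishes, only the box constraint is
  required.\<close>

lemma l1_subgradient_near:
  fixes us :: "real ^ 'p"
  shows "\<forall>\<^sub>F v in nhds us. \<forall>z. (\<forall>i. \<bar>z $ i\<bar> \<le> t \<and> z $ i * v $ i = t * \<bar>v $ i\<bar>) \<longrightarrow>
     (\<forall>i. \<bar>z $ i\<bar> \<le> t \<and> z $ i * us $ i = t * \<bar>us $ i\<bar>)"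
proof -
  have "\<forall>\<^sub>F v in nhds us. \<forall>i. (us $ i > 0 \<longrightarrow> v $ i > 0) \<and> (us $ i < 0 \<longrightarrow> v $ i < 0)"
  proof (rule eventually_all_finite)
    fix i
    have "((\<lambda>v. v $ i) \<longlongrightarrow> us $ i) (nhds us)"
      by (intro tendsto_vec_nth) (rule filterlim_ident)
    note lim = order_tendstoD[OF this]
    show "\<forall>\<^sub>F v in nhds us. (us $ i > 0 \<longrightarrow> v $ i > 0) \<and> (us $ i < 0 \<longrightarrow> v $ i < 0)"
      using lim(1)[of 0] lim(2)[of 0] by (intro eventually_conj) (auto simp: eventually_mono)
  qed
  then show ?thesis
  proof eventually_elim
    case (elim v)
    have "z $ i * us $ i = t * \<bar>us $ i\<bar>" if "z $ i * v $ i = t * \<bar>v $ i\<bar>" for z :: "real ^ 'p" and i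
    proof -
      consider "us $ i = 0" | "us $ i > 0" "v $ i > 0" | "us $ i < 0" "v $ i < 0"
        using elim[rule_format, of i] by linarith
      then show ?thesis
      proof cases
        case 2
        then have "z $ i = t" using that by simp
        then show ?thesis using 2 by simp
      next
        case 3
        then have "v $ i * (z $ i + t) = 0" using that by (simp add: algebra_simps)
        then have "z $ i = - t" using 3 by simp
        then show ?thesis using 3 by simp
      qed simp
    qed
    then show ?case by blast
  qed
qed

lemma norm_snd_prod_le: "norm (snd p) \<le> norm p"
  by (cases p) (simp add: norm_snd_le)

text \<open>For u near \<open>us\<close> the pair (y, z) satisfies the inequalities of the
  multiplier polyhedron at \<open>us\<close>. The gradient equation reads M (y, z) = -d, so
  Hoffman's bound measures the multiplier error by the norm of d - \<open>ds\<close>, and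
  monotonicity replaces the latter by the residual.\<close>

lemma kkt_error_bound:
  fixes Y :: "real ^ 'p ^ 'n"
  assumes kkt: "(ds, us, ys, zs) \<in> kkt_set Y x c t" and "t > 0"
  shows "\<exists>\<kappa>\<ge>0. \<forall>\<^sub>F u in nhds us. \<forall>d y z. stationary Y x t d u y z \<longrightarrow>
     infdist (d, u, y, z) (kkt_set Y x c t)
       \<le> \<kappa> * norm (d \<bullet> x, transpose Y *v d + c - u)"
proof -
  note ks = kkt[unfolded mem_kkt_set_iff[OF \<open>t > 0\<close>]]
  define M :: "real \<times> (real ^ 'p) \<Rightarrow> real ^ 'n" where "M = (\<lambda>(y, z). y *\<^sub>R x + Y *v z)"
  have "linear M"
    unfolding M_def
    by (rule linearI) (auto simp: algebra_simps matrix_vector_right_distrib matrix_vector_mult_scaleR)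
  \<comment> \<open>Each coordinate gives two rows for the box and one for the equation with
    \<open>us\<close>: only >= is needed there, since <= follows from the box. The scalar multiplier
    is free, hence the 0 in the normals.\<close>
  define F :: "((real \<times> (real ^ 'p)) \<times> real) set" where
    "F = (\<Union>i. {((0, axis i 1), t), ((0, axis i (- 1)), t), ((0, axis i (- us $ i)), - (t * \<bar>us $ i\<bar>))})"
  have F: "(\<forall>(a, \<beta>)\<in>F. a \<bullet> q \<le> \<beta>)
      \<longleftrightarrow> (\<forall>i. \<bar>snd q $ i\<bar> \<le> t \<and> snd q $ i * us $ i = t * \<bar>us $ i\<bar>)" for q
  proof -
    have "(\<forall>(a, \<beta>)\<in>F. a \<bullet> q \<le> \<beta>)
      \<longleftrightarrow> (\<forall>i. snd q $ i \<le> t \<and> - snd q $ i \<le> t \<and> - us $ i * snd q $ i \<le> - (t * \<bar>us $ i\<bar>))"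
      unfolding F_def by (cases q) (auto simp: inner_axis' inner_prod_def)
    also have "\<dots> \<longleftrightarrow> (\<forall>i. \<bar>snd q $ i\<bar> \<le> t \<and> snd q $ i * us $ i = t * \<bar>us $ i\<bar>)"
    proof (intro iff_allI)
      fix i
      have "snd q $ i * us $ i \<le> t * \<bar>us $ i\<bar>" if "\<bar>snd q $ i\<bar> \<le> t"
      proof -
        have "snd q $ i * us $ i \<le> \<bar>snd q $ i\<bar> * \<bar>us $ i\<bar>" by (metis abs_ge_self abs_mult)
        also have "\<dots> \<le> t * \<bar>us $ i\<bar>" using that by (intro mult_right_mono) auto
        finally show ?thesis .
      qed
      then show "(snd q $ i \<le> t \<and> - snd q $ i \<le> t \<and> - us $ i * snd q $ i \<le> - (t * \<bar>us $ i\<bar>))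
        \<longleftrightarrow> (\<bar>snd q $ i\<bar> \<le> t \<and> snd q $ i * us $ i = t * \<bar>us $ i\<bar>)"
        by (auto simp: mult.commute)
    qed
    finally show ?thesis .
  qed
  have "finite F" unfolding F_def by auto
  moreover have "\<forall>(a, \<beta>)\<in>F. a \<bullet> (ys, zs) \<le> \<beta>" unfolding F using ks unfolding stationary_def by simp
  moreover have "M (ys, zs) = - ds"
    using ks unfolding stationary_def M_def by (simp add: eq_neg_iff_add_eq_0 ac_simps)
  ultimately obtain \<kappa> where \<kappa>: "\<kappa> \<ge> 0"
    "\<And>q. (\<forall>(a, \<beta>)\<in>F. a \<bullet> q \<le> \<beta>) \<Longrightarrow>
       \<exists>p. (\<forall>(a, \<beta>)\<in>F. a \<bullet> p \<le> \<beta>) \<and> M p = - ds \<and> norm (q - p) \<le> \<kappa> * norm (M q - - ds)"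
    using hoffman_error_bound[OF \<open>linear M\<close>, of F "(ys, zs)" "- ds"] by blast
  obtain B where B: "B > 0" "\<And>e. norm (transpose Y *v e) \<le> B * norm e"
    using linear_bounded_pos[OF matrix_vector_mul_linear[of "transpose Y"]] by blast
  \<comment> \<open>The three summands of the constant bound the errors in d, in u and in the
    multipliers, proved as \<open>2\<close>, \<open>3\<close> and \<open>4\<close> below.\<close>
  have "\<forall>\<^sub>F u in nhds us. \<forall>d y z. stationary Y x t d u y z \<longrightarrow>
     infdist (d, u, y, z) (kkt_set Y x c t)
       \<le> (\<kappa> + (B * \<kappa> + 1) + \<kappa> * \<kappa>) * norm (d \<bullet> x, transpose Y *v d + c - u)"
    using l1_subgradient_near[where us = us and t = t]
  proof eventually_elim
    case (elim u)
    show ?case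
    proof (intro allI impI)
      fix d y z assume st: "stationary Y x t d u y z"
      define r where "r = (d \<bullet> x, transpose Y *v d + c - u)"
      have "\<forall>(a, \<beta>)\<in>F. a \<bullet> (y, z) \<le> \<beta>" unfolding F
        using elim st unfolding stationary_def by simp
      from \<kappa>(2)[OF this] obtain y' z' where
        p: "\<forall>i. \<bar>z' $ i\<bar> \<le> t \<and> z' $ i * us $ i = t * \<bar>us $ i\<bar>" "M (y', z') = - ds"
          "norm ((y, z) - (y', z')) \<le> \<kappa> * norm (M (y, z) + ds)"
        unfolding F by auto
      have st': "stationary Y x t ds us y' z'"
        using p(1,2) unfolding stationary_def M_def by (simp add: eq_neg_iff_add_eq_0 ac_simps)
      then have mem: "(ds, us, y', z') \<in> kkt_set Y x c t"
        using ks unfolding mem_kkt_set_iff[OF \<open>t > 0\<close>] by simp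
      have "M (y, z) = - d"
        using st unfolding stationary_def M_def by (simp add: eq_neg_iff_add_eq_0 ac_simps)
      then have 1: "norm ((y, z) - (y', z')) \<le> \<kappa> * norm (d - ds)"
        using p(3) by (simp add: norm_minus_commute)
      have us: "us = transpose Y *v ds + c" and dsx: "ds \<bullet> x = 0" using ks by auto
      have 2: "norm (d - ds) \<le> \<kappa> * norm r"
      proof (cases "d = ds")
        case False
        have r_eq: "r = ((d - ds) \<bullet> x, transpose Y *v (d - ds) - (u - us))"
          unfolding r_def us using dsx by (simp add: inner_diff_left matrix_vector_mult_diff_distrib)
        \<comment> \<open>Monotonicity is applied to the KKT point with the multipliers found by
          Hoffman's bound. Their distance is itself of order |d - ds|, so one such factor
          cancels.\<close>
        have "(norm (d - ds))\<^sup>2 \<le> - (((y, z) - (y', z')) \<bullet> r)"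
          using stationary_monotone[OF st st' \<open>t > 0\<close>] unfolding r_eq by (simp add: inner_prod_def)
        also have "\<dots> \<le> norm ((y, z) - (y', z')) * norm r"
          using Cauchy_Schwarz_ineq2[of "(y, z) - (y', z')" r] by linarith
        also have "\<dots> \<le> (\<kappa> * norm (d - ds)) * norm r" using 1 by (intro mult_right_mono) auto
        finally have "norm (d - ds) * norm (d - ds) \<le> norm (d - ds) * (\<kappa> * norm r)"
          by (simp add: power2_eq_square ac_simps)
        then show ?thesis using False by simp
      qed (use \<kappa>(1) in simp)
      have 3: "norm (u - us) \<le> (B * \<kappa> + 1) * norm r"
      proof -
        have "u - us = transpose Y *v (d - ds) - snd r"
          unfolding us r_def by (simp add: matrix_vector_mult_diff_distrib)
        also have "norm \<dots> \<le> norm (transpose Y *v (d - ds)) + norm (snd r)" by (rule norm_triangle_ineq4)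
        also have "\<dots> \<le> B * norm (d - ds) + norm r"
          by (intro add_mono B(2) norm_snd_prod_le)
        also have "\<dots> \<le> B * (\<kappa> * norm r) + norm r" using 2 B(1) by simp
        finally show ?thesis by (simp add: algebra_simps)
      qed
      have 4: "norm ((y, z) - (y', z')) \<le> \<kappa> * \<kappa> * norm r"
        using order_trans[OF 1 mult_left_mono[OF 2 \<kappa>(1)]] by (simp add: ac_simps)
      have "infdist (d, u, y, z) (kkt_set Y x c t) \<le> dist (d, u, y, z) (ds, us, y', z')"
        using mem by (rule infdist_le)
      also have "\<dots> \<le> norm (d - ds) + norm (u - us, (y, z) - (y', z'))"
        unfolding dist_norm by (simp add: norm_Pair_le)
      also have "\<dots> \<le> norm (d - ds) + (norm (u - us) + norm ((y, z) - (y', z')))"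
        by (intro add_left_mono norm_Pair_le)
      also have "\<dots> \<le> \<kappa> * norm r + ((B * \<kappa> + 1) * norm r + \<kappa> * \<kappa> * norm r)"
        using 2 3 4 by (intro add_mono)
      finally show "infdist (d, u, y, z) (kkt_set Y x c t)
          \<le> (\<kappa> + (B * \<kappa> + 1) + \<kappa> * \<kappa>) * norm (d \<bullet> x, transpose Y *v d + c - u)"
        unfolding r_def by (simp add: algebra_simps)
    qed
  qed
  moreover have "\<kappa> + (B * \<kappa> + 1) + \<kappa> * \<kappa> \<ge> 0" using \<kappa>(1) B(1) by simp
  ultimately show ?thesis by blast
qed

section \<open>One step of the method\<close>

text \<open>The exact minimizer is the reference point for the inexact iterate. Updated multipliers
  differ by \<open>\<sigma>\<close> times the difference of the residuals, so the penalty part of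
  the growth estimate is their squared distance over 2 \<open>\<sigma>\<close>.\<close>

lemma exact_step:
  fixes Y :: "real ^ 'p ^ 'n"
  assumes "\<sigma> > 0" "t > 0"
  shows "\<exists>dh uh yh zh. stationary Y x t dh uh yh zh
     \<and> (yh, zh) = (y, z) + \<sigma> *\<^sub>R (dh \<bullet> x, transpose Y *v dh + c - uh)
     \<and> (\<forall>d u y' z'. (y', z') = (y, z) + \<sigma> *\<^sub>R (d \<bullet> x, transpose Y *v d + c - u) \<longrightarrow>
          (norm (d - dh))\<^sup>2 / 2 + (norm ((y', z') - (yh, zh)))\<^sup>2 / (2 * \<sigma>)
            \<le> subproblem_gap Y x c t \<sigma> y z (d, u))"
proof -
  obtain dh uh where w:
    "aug_lagrangian Y x c t \<sigma> y z (dh, uh) = (INF v. aug_lagrangian Y x c t \<sigma> y z v)"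
    "\<And>v. aug_lagrangian Y x c t \<sigma> y z (dh, uh) \<le> aug_lagrangian Y x c t \<sigma> y z v"
    using aug_lagrangian_min_attained[OF assms, of Y x c y z] by force
  define yh where "yh = y + \<sigma> * (dh \<bullet> x)"
  define zh where "zh = z + \<sigma> *\<^sub>R (transpose Y *v dh + c - uh)"
  have st: "stationary Y x t dh uh yh zh"
    unfolding yh_def zh_def using w(2) assms(2) by (rule aug_lagrangian_minimizer_stationary)
  have "(norm (d - dh))\<^sup>2 / 2 + (norm ((y', z') - (yh, zh)))\<^sup>2 / (2 * \<sigma>)
            \<le> subproblem_gap Y x c t \<sigma> y z (d, u)"
    if eq: "(y', z') = (y, z) + \<sigma> *\<^sub>R (d \<bullet> x, transpose Y *v d + c - u)" for d u y' z'
  proof -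
    define a where "a = (d - dh) \<bullet> x"
    define e where "e = transpose Y *v (d - dh) - (u - uh)"
    have "(y', z') - (yh, zh) = \<sigma> *\<^sub>R (a, e)"
      using eq unfolding yh_def zh_def a_def e_def
      by (simp add: inner_diff_left matrix_vector_mult_diff_distrib algebra_simps)
    then have "(norm ((y', z') - (yh, zh)))\<^sup>2 = \<sigma>\<^sup>2 * (a\<^sup>2 + (norm e)\<^sup>2)"
      by (simp add: power_mult_distrib norm_Pair del: scaleR_Pair)
    then have "(norm ((y', z') - (yh, zh)))\<^sup>2 / (2 * \<sigma>) = \<sigma> / 2 * a\<^sup>2 + \<sigma> / 2 * (norm e)\<^sup>2"
      using assms(1) by (simp add: field_simps power2_eq_square)
    then show ?thesis
      using aug_lagrangian_growth[OF st[unfolded yh_def zh_def] assms(2), of d u]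
      unfolding subproblem_gap_def w(1)[symmetric] a_def e_def by simp
  qed
  then show ?thesis using st unfolding yh_def zh_def by (intro exI conjI allI impI) auto
qed

text \<open>This is firm nonexpansiveness of the proximal step. With p = \<open>\<mu>h\<close> -
  \<open>\<mu>s\<close> and q = \<open>\<mu>h\<close> - \<open>\<mu>\<close>, which is
  \<open>\<sigma>\<close> times the residual, monotonicity bounds p . q from above; this goes into
  the expansion of |p - q|^2.\<close>

lemma exact_step_fejer:
  fixes Y :: "real ^ 'p ^ 'n"
  assumes st: "stationary Y x t dh uh yh zh"
    and step: "(yh, zh) = (y, z) + \<sigma> *\<^sub>R (dh \<bullet> x, transpose Y *v dh + c - uh)"
    and kkt: "(ds, us, ys, zs) \<in> kkt_set Y x c t" and "\<sigma> > 0" "t > 0"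
  shows "(norm ((yh, zh) - (ys, zs)))\<^sup>2 + (norm ((yh, zh) - (y, z)))\<^sup>2 + 2 * \<sigma> * (norm (dh - ds))\<^sup>2
     \<le> (norm ((y, z) - (ys, zs)))\<^sup>2"
proof -
  note ks = kkt[unfolded mem_kkt_set_iff[OF \<open>t > 0\<close>]]
  define p where "p = (yh, zh) - (ys, zs)"
  define q where "q = (yh, zh) - (y, z)"
  define r where "r = (dh \<bullet> x, transpose Y *v dh + c - uh)"
  have q: "q = \<sigma> *\<^sub>R r" unfolding q_def step r_def by simp
  have "r = ((dh - ds) \<bullet> x, transpose Y *v (dh - ds) - (uh - us))"
    unfolding r_def using ks by (auto simp: inner_diff_left matrix_vector_mult_diff_distrib)
  then have "(norm (dh - ds))\<^sup>2 + p \<bullet> r \<le> 0"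
    using stationary_monotone[OF st conjunct1[OF ks] \<open>t > 0\<close>]
    unfolding p_def by (simp add: inner_prod_def)
  then have "\<sigma> * ((norm (dh - ds))\<^sup>2 + p \<bullet> r) \<le> 0"
    using \<open>\<sigma> > 0\<close> by (simp add: mult_le_0_iff)
  then have "2 * \<sigma> * (norm (dh - ds))\<^sup>2 + 2 * (p \<bullet> q) \<le> 0"
    unfolding q by (simp add: algebra_simps)
  moreover have "(norm ((y, z) - (ys, zs)))\<^sup>2 = (norm p)\<^sup>2 + (norm q)\<^sup>2 - 2 * (p \<bullet> q)"
  proof -
    have "(y, z) - (ys, zs) = p - q" unfolding p_def q_def by simp
    then show ?thesis unfolding power2_norm_eq_inner
      by (simp only: inner_diff_left inner_diff_right inner_commute[of q p])
  qed
  ultimately show ?thesis unfolding p_def q_def by linarith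
qed

text \<open>Subtracting the partial sums of the errors leaves a decreasing sequence bounded
  below.\<close>

lemma almost_decreasing_convergent:
  fixes a \<epsilon> :: "nat \<Rightarrow> real"
  assumes "\<And>j. 0 \<le> a j" "\<And>j. 0 \<le> \<epsilon> j" "summable \<epsilon>" "\<And>j. a (Suc j) \<le> a j + \<epsilon> j"
  shows "convergent a"
proof -
  define b where "b j = a j - (\<Sum>k<j. \<epsilon> k)" for j
  have "decseq b" unfolding b_def using assms(4) by (intro decseq_SucI) (simp add: algebra_simps)
  moreover have "- suminf \<epsilon> \<le> b j" for j
    unfolding b_def using assms(1)[of j] sum_le_suminf[OF assms(3), of "{..<j}"] assms(2) by simp
  ultimately have "convergent b"
    using decseq_convergent by (metis convergentI)
  moreover have "convergent (\<lambda>j. \<Sum>k<j. \<epsilon> k)" using assms(3) by (simp add: summable_iff_convergent)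
  ultimately have "convergent (\<lambda>j. b j + (\<Sum>k<j. \<epsilon> k))" by (rule convergent_add)
  then show ?thesis unfolding b_def by simp
qed

lemma tendsto_zero_norm_square:
  fixes v :: "nat \<Rightarrow> 'a::real_normed_vector"
  assumes "(\<lambda>j. (norm (v j))\<^sup>2) \<longlonglongrightarrow> 0"
  shows "v \<longlonglongrightarrow> 0"
  using tendsto_real_sqrt[OF assms] by (simp add: tendsto_norm_zero_iff)

section \<open>Convergence\<close>

theorem propositionD1:
  fixes Y :: "real ^ 'p ^ 'n" and x :: "real ^ 'n" and c :: "real ^ 'p" and t :: real
    and \<sigma> :: "nat \<Rightarrow> real" and \<sigma>_inf :: ereal
    and d :: "nat \<Rightarrow> real ^ 'n" and u :: "nat \<Rightarrow> real ^ 'p"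
    and y :: "nat \<Rightarrow> real" and z :: "nat \<Rightarrow> real ^ 'p" and \<epsilon> :: "nat \<Rightarrow> real"
  assumes "norm x = 1" and "c = transpose Y *v x" and "t > 0"
    and "alm_sequence Y x c \<sigma> \<sigma>_inf d u y z"
    and "stopping_A Y x c t \<sigma> d u y z \<epsilon>"
  shows "bounded (range (\<lambda>j. (d j, u j))) \<and>
    (\<exists>w. optimal_solution Y x c t w \<and> (\<forall>w'. optimal_solution Y x c t w' \<longrightarrow> w' = w) \<and>
         (\<lambda>j. (d j, u j)) \<longlonglongrightarrow> w) \<and>
    (\<forall>\<delta> \<delta>'. \<sigma>_inf = \<infinity> \<and> stopping_B Y x c t \<sigma> d u y z \<delta> \<and> stopping_C Y x c t \<sigma> d u y z \<delta>' \<longrightarrow>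
       (\<exists>\<eta>. (\<forall>j. 0 \<le> \<eta> j) \<and> \<eta> \<longlonglongrightarrow> 0 \<and>
         (\<forall>\<^sub>F j in sequentially.
            infdist (d (Suc j), u (Suc j), y (Suc j), z (Suc j)) (kkt_set Y x c t)
              \<le> \<eta> j * infdist (d j, u j, y j, z j) (kkt_set Y x c t))))"
proof -
  let ?K = "kkt_set Y x c t"
  define \<mu> where "\<mu> j = (y j, z j)" for j
  define res where "res d u = (d \<bullet> x, transpose Y *v d + c - u)" for d u
  note alm = assms(4)[unfolded alm_sequence_def]
  have "incseq \<sigma>" using alm by (intro incseq_SucI) auto
  then have \<sigma>0: "\<sigma> 0 \<le> \<sigma> j" for j by (simp add: incseqD)
  then have \<sigma>: "\<sigma> j > 0" for j using alm less_le_trans by blast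
  have \<mu>_Suc: "\<mu> (Suc j) = \<mu> j + \<sigma> j *\<^sub>R res (d (Suc j)) (u (Suc j))" for j
    unfolding \<mu>_def res_def using alm by simp
  have res_Suc: "res (d (Suc j)) (u (Suc j)) = (1 / \<sigma> j) *\<^sub>R (\<mu> (Suc j) - \<mu> j)" for j
    unfolding \<mu>_Suc using \<sigma>[of j] by simp
  have \<epsilon>: "\<And>j. 0 \<le> \<epsilon> j" "summable \<epsilon>" using assms(5) unfolding stopping_A_def by auto

  \<comment> \<open>Exact steps alongside the computed iterates\<close>
  have "\<forall>j. \<exists>dh uh yh zh. stationary Y x t dh uh yh zh \<and> (yh, zh) = \<mu> j + \<sigma> j *\<^sub>R res dh uh
      \<and> (norm (d (Suc j) - dh))\<^sup>2 / 2 + (norm (\<mu> (Suc j) - (yh, zh)))\<^sup>2 / (2 * \<sigma> j)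
          \<le> subproblem_gap Y x c t (\<sigma> j) (y j) (z j) (d (Suc j), u (Suc j))"
    using exact_step[OF \<sigma> assms(3), of Y x _ _ _ c] \<mu>_Suc unfolding \<mu>_def res_def by meson
  then obtain dh uh yh zh where
    st: "\<And>j. stationary Y x t (dh j) (uh j) (yh j) (zh j)" and
    step: "\<And>j. (yh j, zh j) = \<mu> j + \<sigma> j *\<^sub>R res (dh j) (uh j)" and
    gap: "\<And>j. (norm (d (Suc j) - dh j))\<^sup>2 / 2 + (norm (\<mu> (Suc j) - (yh j, zh j)))\<^sup>2 / (2 * \<sigma> j)
          \<le> subproblem_gap Y x c t (\<sigma> j) (y j) (z j) (d (Suc j), u (Suc j))"
    by metis
  define \<mu>h where "\<mu>h j = (yh j, zh j)" for j
  have res_h: "res (dh j) (uh j) = (1 / \<sigma> j) *\<^sub>R (\<mu>h j - \<mu> j)" for j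
    unfolding \<mu>h_def step using \<sigma>[of j] by simp
  have fejer: "(norm (\<mu>h j - (ys, zs)))\<^sup>2 + (norm (\<mu>h j - \<mu> j))\<^sup>2 + 2 * \<sigma> j * (norm (dh j - ds))\<^sup>2
     \<le> (norm (\<mu> j - (ys, zs)))\<^sup>2" if "(ds, us, ys, zs) \<in> ?K" for j ds us ys zs
    using exact_step_fejer[OF st _ that \<sigma> assms(3)] step
    unfolding \<mu>h_def \<mu>_def res_def by blast
  \<comment> \<open>The tolerance e is kept general: it is \<open>\<epsilon> j\<close> under
    criterion (A) and \<open>\<delta> j\<close> times the length of the multiplier step under
    (B).\<close>
  have gap_bound: "norm (\<mu> (Suc j) - \<mu>h j) \<le> e" "norm (d (Suc j) - dh j) \<le> e / sqrt (\<sigma> j)"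
    if "subproblem_gap Y x c t (\<sigma> j) (y j) (z j) (d (Suc j), u (Suc j)) \<le> e\<^sup>2 / (2 * \<sigma> j)" "0 \<le> e" for j e
  proof -
    have *: "(norm (d (Suc j) - dh j))\<^sup>2 / 2 + (norm (\<mu> (Suc j) - \<mu>h j))\<^sup>2 / (2 * \<sigma> j) \<le> e\<^sup>2 / (2 * \<sigma> j)"
      using gap[of j] that(1) unfolding \<mu>h_def by linarith
    have nn: "0 \<le> (norm (d (Suc j) - dh j))\<^sup>2 / 2" "0 \<le> (norm (\<mu> (Suc j) - \<mu>h j))\<^sup>2 / (2 * \<sigma> j)"
      using \<sigma>[of j] by simp_all
    have "(norm (\<mu> (Suc j) - \<mu>h j))\<^sup>2 / (2 * \<sigma> j) \<le> e\<^sup>2 / (2 * \<sigma> j)" using * nn by linarith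
    then have "(norm (\<mu> (Suc j) - \<mu>h j))\<^sup>2 \<le> e\<^sup>2" using \<sigma>[of j] by (simp add: divide_le_cancel)
    then show "norm (\<mu> (Suc j) - \<mu>h j) \<le> e" using that(2) by (rule power2_le_imp_le)
    have "(norm (d (Suc j) - dh j))\<^sup>2 \<le> e\<^sup>2 / \<sigma> j" using * nn by (simp add: field_simps)
    also have "\<dots> = (e / sqrt (\<sigma> j))\<^sup>2" using \<sigma>[of j] by (simp add: power_divide)
    finally show "norm (d (Suc j) - dh j) \<le> e / sqrt (\<sigma> j)"
      by (rule power2_le_imp_le) (use that(2) \<sigma>[of j] in simp)
  qed
  have A: "norm (\<mu> (Suc j) - \<mu>h j) \<le> \<epsilon> j" "norm (d (Suc j) - dh j) \<le> \<epsilon> j / sqrt (\<sigma> j)" for j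
    using gap_bound[of j "\<epsilon> j"] assms(5) unfolding stopping_A_def by auto
  have \<epsilon>_0: "\<epsilon> \<longlonglongrightarrow> 0" using \<epsilon>(2) by (rule summable_LIMSEQ_zero)

  \<comment> \<open>Convergence of the primal iterates\<close>
  obtain ds us ys zs where kkt: "(ds, us, ys, zs) \<in> ?K"
    using kkt_set_nonempty[OF assms(1,3), of Y c] by auto
  have us: "us = transpose Y *v ds + c" using kkt unfolding mem_kkt_set_iff[OF assms(3)] by auto
  define a where "a j = norm (\<mu> j - (ys, zs))" for j
  define ah where "ah j = norm (\<mu>h j - (ys, zs))" for j
  have ah_le: "ah j \<le> a j" for j
  proof -
    have "(ah j)\<^sup>2 \<le> (a j)\<^sup>2" using fejer[OF kkt, of j] \<sigma>[of j] unfolding a_def ah_def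
      by (smt (verit) zero_le_power2 mult_nonneg_nonneg)
    then show ?thesis unfolding a_def by (rule power2_le_imp_le) simp
  qed
  have a_Suc: "a (Suc j) \<le> ah j + \<epsilon> j" for j
    unfolding a_def ah_def using norm_diff_triangle_le[OF A(1)[of j] order_refl, of "(ys, zs)"]
    by linarith
  have "convergent a"
    using \<epsilon> order_trans[OF a_Suc add_right_mono[OF ah_le]]
    by (intro almost_decreasing_convergent[of a \<epsilon>]) (auto simp: a_def)
  then obtain l where l: "a \<longlonglongrightarrow> l" unfolding convergent_def by blast
  \<comment> \<open>The exact distances are squeezed between a (Suc j) - \<open>\<epsilon> j\<close>
    and a j.\<close>
  have "ah \<longlonglongrightarrow> l"
  proof (rule tendsto_sandwich)
    show "(\<lambda>j. a (Suc j) - \<epsilon> j) \<longlonglongrightarrow> l"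
      using tendsto_diff[OF LIMSEQ_Suc[OF l] \<epsilon>_0] by simp
  qed (use l ah_le a_Suc in \<open>auto simp: le_diff_eq diff_le_eq\<close>)
  \<comment> \<open>By \<open>fejer\<close> this vanishing difference dominates both the squared
    exact multiplier step and the squared error of \<open>dh\<close>.\<close>
  then have drop: "(\<lambda>j. (a j)\<^sup>2 - (ah j)\<^sup>2) \<longlonglongrightarrow> 0"
    using tendsto_diff[OF tendsto_power[OF l] tendsto_power, of ah l 2 2] by simp
  have "(\<lambda>j. (norm (\<mu>h j - \<mu> j))\<^sup>2) \<longlonglongrightarrow> 0"
  proof (rule tendsto_sandwich[OF _ _ tendsto_const drop])
    show "\<forall>\<^sub>F j in sequentially. (norm (\<mu>h j - \<mu> j))\<^sup>2 \<le> (a j)\<^sup>2 - (ah j)\<^sup>2"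
      using fejer[OF kkt] \<sigma> unfolding a_def ah_def
      by (intro always_eventually allI) (smt (verit) zero_le_power2 mult_nonneg_nonneg)
  qed simp
  then have step_0: "(\<lambda>j. \<mu>h j - \<mu> j) \<longlonglongrightarrow> 0"
    by (rule tendsto_zero_norm_square)
  have "(\<lambda>j. (norm (dh j - ds))\<^sup>2) \<longlonglongrightarrow> 0"
  proof (rule tendsto_sandwich[OF _ _ tendsto_const])
    show "(\<lambda>j. ((a j)\<^sup>2 - (ah j)\<^sup>2) / (2 * \<sigma> 0)) \<longlonglongrightarrow> 0"
      using tendsto_divide_zero[OF drop] .
    have "(norm (dh j - ds))\<^sup>2 \<le> ((a j)\<^sup>2 - (ah j)\<^sup>2) / (2 * \<sigma> 0)" for j
    proof -
      have "2 * \<sigma> 0 * (norm (dh j - ds))\<^sup>2 \<le> 2 * \<sigma> j * (norm (dh j - ds))\<^sup>2"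
        using \<sigma>0[of j] by (intro mult_right_mono) auto
      also have "\<dots> \<le> (a j)\<^sup>2 - (ah j)\<^sup>2"
        using fejer[OF kkt, of j] unfolding a_def ah_def by (smt (verit) zero_le_power2)
      finally show ?thesis using \<sigma>[of 0] by (simp add: field_simps)
    qed
    then show "\<forall>\<^sub>F j in sequentially. (norm (dh j - ds))\<^sup>2 \<le> ((a j)\<^sup>2 - (ah j)\<^sup>2) / (2 * \<sigma> 0)" by simp
  qed simp
  then have "(\<lambda>j. dh j - ds) \<longlonglongrightarrow> 0"
    by (rule tendsto_zero_norm_square)
  then have dh: "dh \<longlonglongrightarrow> ds" by (simp add: LIM_zero_iff)
  have inv_bounded: "1 / \<sigma> j \<le> 1 / \<sigma> 0" for j
    using \<sigma>0[of j] \<sigma>[of 0] by (simp add: frac_le)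
  have scaled_0: "(\<lambda>j. (1 / \<sigma> j) *\<^sub>R v j) \<longlonglongrightarrow> 0" if "v \<longlonglongrightarrow> 0" for v :: "nat \<Rightarrow> real \<times> (real ^ 'p)"
  proof (rule tendsto_0_le[OF that, of _ "1 / \<sigma> 0"])
    have "norm ((1 / \<sigma> j) *\<^sub>R v j) \<le> norm (v j) * (1 / \<sigma> 0)" for j
      using mult_right_mono[OF inv_bounded[of j] norm_ge_zero[of "v j"]] \<sigma>[of j] by simp
    then show "\<forall>\<^sub>F j in sequentially. norm ((1 / \<sigma> j) *\<^sub>R v j) \<le> norm (v j) * (1 / \<sigma> 0)" by simp
  qed
  \<comment> \<open>The second component is recovered from the first and from the residual, so its
    limit needs no estimate of its own.\<close>
  have primal_lim: "w \<longlonglongrightarrow> us" if "v \<longlonglongrightarrow> ds" "(\<lambda>j. res (v j) (w j)) \<longlonglongrightarrow> 0" for v w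
  proof -
    have "(\<lambda>j. transpose Y *v v j + c - snd (res (v j) (w j))) \<longlonglongrightarrow> transpose Y *v ds + c - snd (0 :: real \<times> (real ^ 'p))"
      by (intro tendsto_diff tendsto_add tendsto_const tendsto_snd[OF that(2)]
          bounded_linear.tendsto[OF matrix_vector_mul_bounded_linear that(1)])
    then show ?thesis unfolding res_def us by simp
  qed
  have uh: "uh \<longlonglongrightarrow> us"
    using dh scaled_0[OF step_0] by (intro primal_lim[of dh]) (simp_all add: res_h)
  have "(\<lambda>j. \<mu> (Suc j) - \<mu>h j) \<longlonglongrightarrow> 0"
    using A(1) by (intro tendsto_0_le[OF \<epsilon>_0, of _ 1]) (simp add: \<epsilon>(1))
  from tendsto_add[OF this step_0] have "(\<lambda>j. \<mu> (Suc j) - \<mu> j) \<longlonglongrightarrow> 0" by simp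
  note res_0 = scaled_0[OF this, folded res_Suc]
  have "(\<lambda>j. d (Suc j) - dh j) \<longlonglongrightarrow> 0"
  proof (rule tendsto_0_le[OF \<epsilon>_0, of _ "1 / sqrt (\<sigma> 0)"])
    have "norm (d (Suc j) - dh j) \<le> norm (\<epsilon> j) * (1 / sqrt (\<sigma> 0))" for j
    proof -
      have "\<epsilon> j / sqrt (\<sigma> j) \<le> \<epsilon> j / sqrt (\<sigma> 0)"
        using \<sigma>0[of j] \<sigma>[of 0] \<epsilon>(1)[of j] by (intro divide_left_mono) auto
      then show ?thesis using A(2)[of j] \<epsilon>(1)[of j] by simp
    qed
    then show "\<forall>\<^sub>F j in sequentially. norm (d (Suc j) - dh j) \<le> norm (\<epsilon> j) * (1 / sqrt (\<sigma> 0))" by simp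
  qed
  from tendsto_add[OF this dh] have d_Suc: "(\<lambda>j. d (Suc j)) \<longlonglongrightarrow> ds" by simp
  \<comment> \<open>The estimates concern indices Suc j only, as the starting point is arbitrary;
    the shift is removed here.\<close>
  have "(\<lambda>j. (d j, u j)) \<longlonglongrightarrow> (ds, us)"
    using LIMSEQ_imp_Suc[OF d_Suc] LIMSEQ_imp_Suc[OF primal_lim[OF d_Suc res_0]] by (rule tendsto_Pair)
  moreover have "optimal_solution Y x c t (ds, us)" using kkt assms(3) by (rule kkt_optimal(1))
  moreover have "\<forall>w'. optimal_solution Y x c t w' \<longrightarrow> w' = (ds, us)"
    using kkt_optimal(2)[OF kkt assms(3)] by blast

  \<comment> \<open>Superlinear convergence to the KKT set\<close>
  moreover have "\<exists>\<eta>. (\<forall>j. 0 \<le> \<eta> j) \<and> \<eta> \<longlonglongrightarrow> 0 \<and>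
         (\<forall>\<^sub>F j in sequentially. infdist (d (Suc j), u (Suc j), y (Suc j), z (Suc j)) ?K
              \<le> \<eta> j * infdist (d j, u j, y j, z j) ?K)"
    if "\<sigma>_inf = \<infinity>" and B: "stopping_B Y x c t \<sigma> d u y z \<delta>" for \<delta>
  proof -
    have \<delta>: "\<And>j. 0 \<le> \<delta> j" "\<delta> \<longlonglongrightarrow> 0"
      using B summable_LIMSEQ_zero unfolding stopping_B_def by auto
    have \<sigma>_top: "filterlim \<sigma> at_top sequentially"
      using alm \<open>\<sigma>_inf = \<infinity>\<close> by (simp add: tendsto_PInfty_eq_at_top)
    obtain \<kappa> where \<kappa>: "\<kappa> \<ge> 0" "\<forall>\<^sub>F v in nhds us. \<forall>d y z. stationary Y x t d v y z \<longrightarrow>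
        infdist (d, v, y, z) ?K \<le> \<kappa> * norm (res d v)"
      using kkt_error_bound[OF kkt assms(3)] unfolding res_def by blast
    obtain L where L: "L > 0" "\<And>e. norm (transpose Y *v e) \<le> L * norm e"
      using linear_bounded_pos[OF matrix_vector_mul_linear[of "transpose Y"]] by blast
    define D where "D j = infdist (d j, u j, y j, z j) ?K" for j
    define e where "e j = \<delta> j * norm (\<mu> (Suc j) - \<mu> j)" for j
    \<comment> \<open>\<open>C j\<close> times \<open>e j\<close> collects the deviations from the
      exact step: 1 / sqrt \<open>\<sigma>\<close> for d, L / sqrt \<open>\<sigma>\<close> + 1 /
      \<open>\<sigma>\<close> for u, and 1 for the multipliers. In \<open>\<eta>\<close>, the first
      term is the error bound at the exact step, the second uses e <= 2 \<open>\<delta>\<close>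
      D.\<close>
    define C where "C j = (1 + L) / sqrt (\<sigma> j) + 1 / \<sigma> j + 1" for j
    define \<eta> where "\<eta> j = \<kappa> * (1 / \<sigma> j) + C j * (2 * \<delta> j)" for j
    have inv_0: "(\<lambda>j. 1 / \<sigma> j) \<longlonglongrightarrow> 0"
      using \<sigma>_top by (intro tendsto_divide_0[OF tendsto_const] filterlim_at_top_imp_at_infinity)
    have sqrt_inv_0: "(\<lambda>j. 1 / sqrt (\<sigma> j)) \<longlonglongrightarrow> 0"
      using tendsto_real_sqrt[OF inv_0] by (simp add: real_sqrt_divide)
    have "C \<longlonglongrightarrow> (1 + L) * 0 + 0 + 1"
      unfolding C_def using tendsto_mult_left[OF sqrt_inv_0, of "1 + L"]
      by (intro tendsto_add inv_0 tendsto_const) simp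
    then have "\<eta> \<longlonglongrightarrow> \<kappa> * 0 + ((1 + L) * 0 + 0 + 1) * (2 * 0)"
      unfolding \<eta>_def by (intro tendsto_intros inv_0 \<delta>(2))
    then have "\<eta> \<longlonglongrightarrow> 0" by simp
    moreover have C_pos: "C j \<ge> 0" for j unfolding C_def using L(1) \<sigma>[of j] by simp
    then have "0 \<le> \<eta> j" for j unfolding \<eta>_def using \<kappa>(1) \<sigma>[of j] \<delta>(1)[of j] by simp
    moreover have "\<forall>\<^sub>F j in sequentially. D (Suc j) \<le> \<eta> j * D j"
    proof -
      have "\<forall>\<^sub>F j in sequentially. \<forall>d y z. stationary Y x t d (uh j) y z \<longrightarrow>
          infdist (d, uh j, y, z) ?K \<le> \<kappa> * norm (res d (uh j))"
        using \<kappa>(2) uh by (rule eventually_compose_filterlim)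
      \<comment> \<open>Below 1/2, the multiplier step contained in \<open>e j\<close> can be
        absorbed: its length is at most half itself plus \<open>D j\<close>.\<close>
      moreover have "\<forall>\<^sub>F j in sequentially. \<delta> j < 1 / 2" using \<delta>(2) by (rule order_tendstoD) simp
      ultimately show ?thesis
      proof eventually_elim
        case (elim j)
        \<comment> \<open>The Fejer estimate holds for every KKT point, so the infimum may be taken
          over all of them and the exact step is bounded by the distance to the set.\<close>
        have "norm (\<mu>h j - \<mu> j) \<le> dist (d j, u j, y j, z j) k" if "k \<in> ?K" for k
        proof -
          obtain d' u' y' z' where k: "k = (d', u', y', z')" by (cases k) auto
          have "(norm (\<mu>h j - \<mu> j))\<^sup>2 \<le> (norm (\<mu> j - (y', z')))\<^sup>2"
            using fejer[OF that[unfolded k], of j] \<sigma>[of j]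
            by (smt (verit) zero_le_power2 mult_nonneg_nonneg)
          then have "norm (\<mu>h j - \<mu> j) \<le> norm (\<mu> j - (y', z'))" by (rule power2_le_imp_le) simp
          also have "\<dots> \<le> dist (d j, u j, y j, z j) k"
            unfolding k dist_norm \<mu>_def
            using norm_snd_prod_le[of "(u j, y j, z j) - (u', y', z')"]
              norm_snd_prod_le[of "(d j, u j, y j, z j) - (d', u', y', z')"] by simp
          finally show ?thesis .
        qed
        then have hD: "norm (\<mu>h j - \<mu> j) \<le> D j"
          unfolding D_def infdist_def using kkt by (auto intro!: cINF_greatest)
        have "subproblem_gap Y x c t (\<sigma> j) (y j) (z j) (d (Suc j), u (Suc j)) \<le> (e j)\<^sup>2 / (2 * \<sigma> j)"
          using B unfolding stopping_B_def e_def \<mu>_def by (simp add: power_mult_distrib)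
        moreover have e_pos: "0 \<le> e j" unfolding e_def using \<delta>(1) by simp
        ultimately have close: "norm (\<mu> (Suc j) - \<mu>h j) \<le> e j" "norm (d (Suc j) - dh j) \<le> e j / sqrt (\<sigma> j)"
          using gap_bound by blast+
        have "norm (\<mu> (Suc j) - \<mu> j) \<le> e j + D j"
          using norm_triangle_ineq[of "\<mu> (Suc j) - \<mu>h j" "\<mu>h j - \<mu> j"] close(1) hD by simp
        moreover have "e j \<le> 1 / 2 * norm (\<mu> (Suc j) - \<mu> j)"
          unfolding e_def using elim(2) by (intro mult_right_mono) auto
        ultimately have "norm (\<mu> (Suc j) - \<mu> j) \<le> 2 * D j" by linarith
        then have eD: "e j \<le> 2 * \<delta> j * D j"
          unfolding e_def using mult_left_mono[OF _ \<delta>(1)[of j]] by fastforce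
        \<comment> \<open>Both residuals are multiplier steps from the same \<open>\<mu> j\<close>
          divided by \<open>\<sigma> j\<close>, so \<open>\<mu> j\<close> cancels in their
          difference.\<close>
        have "u (Suc j) - uh j
            = transpose Y *v (d (Suc j) - dh j) - (1 / \<sigma> j) *\<^sub>R snd (\<mu> (Suc j) - \<mu>h j)"
        proof -
          have "u (Suc j) - uh j = transpose Y *v (d (Suc j) - dh j)
              - (snd (res (d (Suc j)) (u (Suc j))) - snd (res (dh j) (uh j)))"
            unfolding res_def by (simp add: matrix_vector_mult_diff_distrib)
          then show ?thesis unfolding res_Suc res_h by (simp add: algebra_simps)
        qed
        also have "norm \<dots> \<le> norm (transpose Y *v (d (Suc j) - dh j))
            + norm ((1 / \<sigma> j) *\<^sub>R snd (\<mu> (Suc j) - \<mu>h j))" by (rule norm_triangle_ineq4)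
        also have "\<dots> \<le> L * (e j / sqrt (\<sigma> j)) + 1 / \<sigma> j * e j"
        proof (rule add_mono)
          show "norm (transpose Y *v (d (Suc j) - dh j)) \<le> L * (e j / sqrt (\<sigma> j))"
            using order_trans[OF L(2) mult_left_mono[OF close(2)]] L(1) by simp
          show "norm ((1 / \<sigma> j) *\<^sub>R snd (\<mu> (Suc j) - \<mu>h j)) \<le> 1 / \<sigma> j * e j"
            using order_trans[OF norm_snd_prod_le close(1)] \<sigma>[of j]
            by (simp add: divide_right_mono)
        qed
        finally have close_u: "norm (u (Suc j) - uh j) \<le> L * (e j / sqrt (\<sigma> j)) + 1 / \<sigma> j * e j" .
        \<comment> \<open>The detour over the exact step is needed because the error bound applies
          to stationary points; criterion (B) controls the remaining distance.\<close>
        have "D (Suc j) \<le> infdist (dh j, uh j, \<mu>h j) ?K + dist (d (Suc j), u (Suc j), \<mu> (Suc j)) (dh j, uh j, \<mu>h j)"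
          unfolding D_def \<mu>_def by (rule infdist_triangle)
        also have "infdist (dh j, uh j, \<mu>h j) ?K \<le> \<kappa> * (1 / \<sigma> j) * D j"
        proof -
          have "infdist (dh j, uh j, \<mu>h j) ?K \<le> \<kappa> * norm (res (dh j) (uh j))"
            using elim(1) st unfolding \<mu>h_def by blast
          also have "\<dots> = \<kappa> * (1 / \<sigma> j) * norm (\<mu>h j - \<mu> j)" unfolding res_h using \<sigma>[of j] by simp
          also have "\<dots> \<le> \<kappa> * (1 / \<sigma> j) * D j"
            using hD \<kappa>(1) \<sigma>[of j] by (intro mult_left_mono) auto
          finally show ?thesis .
        qed
        also have "dist (d (Suc j), u (Suc j), \<mu> (Suc j)) (dh j, uh j, \<mu>h j)
            \<le> norm (d (Suc j) - dh j) + (norm (u (Suc j) - uh j) + norm (\<mu> (Suc j) - \<mu>h j))"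
          unfolding dist_norm diff_Pair
          by (rule order_trans[OF norm_Pair_le]) (intro add_left_mono norm_Pair_le)
        also have "\<dots> \<le> C j * e j"
          using close close_u unfolding C_def by (simp add: algebra_simps add_divide_distrib)
        also have "\<dots> \<le> C j * (2 * \<delta> j * D j)" using eD C_pos by (rule mult_left_mono)
        finally show ?case unfolding \<eta>_def by (simp add: algebra_simps)
      qed
    qed
    ultimately show ?thesis unfolding D_def by blast
  qed
  moreover have "bounded (range (\<lambda>j. (d j, u j)))"
    using \<open>(\<lambda>j. (d j, u j)) \<longlonglongrightarrow> (ds, us)\<close> by (rule convergent_imp_bounded)
  ultimately show ?thesis by blast
qed

end
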